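(* Let $d\ge1$, let $\eta$ be a random vector in $\mathbb{R}^d$ with $\mathbb{E}|\eta|^2<\infty$, and let $m:=\mathbb{E}\,\eta$. Let $(T_n)_{n\ge0}$ be the random recursive tree, and let $\widetilde\mu_n$ be the empirical distribution of the branching random walk on $T_n$ with offset $\eta$. Then, as $n\to\infty$, almost surely $$\Theta_{\sqrt{\log n},\,m\log n}(\widetilde\mu_n)\longrightarrow N\bigl(0,\mathbb{E}[\eta\eta^{\mathsf t}]\bigr)$$ in $\mathcal{P}(\mathbb{R}^d)$ with the usual weak topology. More generally, the same result holds for the weighted random recursive tree with an arbitrary weight $\rho>0$.
   Context: Vectors are column vectors, and ${}^{\mathsf t}$ denotes transpose. $\mathcal{P}(\mathbb{R}^d)$ is the space of Borel probability measures on $\mathbb{R}^d$, $\delta_x$ is the point mass at $x$, and $N(0,\Sigma)$ is the (possibly degenerate) normal distribution with mean $0$ and covariance matrix $\Sigma$. For $a>0$ and $b\in\mathbb{R}^d$, the map $\Theta_{a,b}:\mathcal{P}(\mathbb{R}^d)\to\mathcal{P}(\mathbb{R}^d)$ is defined by: if $X\sim\mu$, then $(X-b)/a\sim\Theta_{a,b}(\mu)$. Weighted random recursive tree with weight $\rho>0$: the root $o$ has weight $\omega_o=\rho$ and every other node $v$ has weight $\omega_v=1$. $T_0$ consists of the root only. Given $T_n$ (which has $n+1$ nodes), $T_{n+1}$ is obtained by adding a new node and choosing its parent randomly among the existing nodes with probability proportional to weight, i.e. the root with probability $\rho/(n+\rho)$ and each other existing node with probability $1/(n+\rho)$. The random recursive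 tree is the case $\rho=1$ (uniformly random parent). $|T_n|=n+\rho$ denotes the total weight. Let $T_\infty:=\bigcup_n T_n$. Branching random walk: let $(\eta_v)_{v\in T_\infty}$ be i.i.d. copies of $\eta$, independent of the tree process $(T_n)_n$. Set $X_o:=0$, and $X_w:=X_v+\eta_w$ if $w$ is a child of $v$. The empirical distribution is the random probability measure $$\widetilde\mu_n:=\frac1{|T_n|}\sum_{v\in T_n}\omega_v\,\delta_{X_v}.$$ *)

theory Defs
  imports "HOL-Probability.Probability"
begin

section \<open>Probability measures on Euclidean space\<close>

definition weakly_converges :: "(nat \<Rightarrow> 'v::topological_space measure) \<Rightarrow> 'v measure \<Rightarrow> bool" where
  "weakly_converges \<mu> \<nu> \<longleftrightarrow>
     (\<forall>f :: 'v \<Rightarrow> real. continuous_on UNIV f \<longrightarrow> bounded (range f) \<longrightarrow>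
        (\<lambda>n. integral\<^sup>L (\<mu> n) f) \<longlonglongrightarrow> integral\<^sup>L \<nu> f)"

definition rescale :: "real \<Rightarrow> 'v::real_normed_vector \<Rightarrow> 'v measure \<Rightarrow> 'v measure" where
  "rescale a b \<mu> = distr \<mu> borel (\<lambda>x. (x - b) /\<^sub>R a)"

definition std_normal_vec :: "(real ^ 'd) measure" where
  "std_normal_vec = distr (Pi\<^sub>M UNIV (\<lambda>_. std_normal_distribution)) borel (\<lambda>z. \<chi> i. z i)"

text \<open>\<open>N(0, S)\<close> is the law of \<open>A Z\<close>, where \<open>Z\<close> is a standard normal vector and \<open>A A\<^sup>t = S\<close>;
  this covers singular \<open>S\<close>.  Such an \<open>A\<close> exists for every symmetric positive semidefinite \<open>S\<close>
  (lemma \<open>ex_matrix_root\<close>), and the law does not depend on its choice: its characteristic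
  function is a function of \<open>S\<close> alone (lemma \<open>char_centered_normal\<close>).\<close>

definition centered_normal :: "real ^ 'd ^ 'd \<Rightarrow> (real ^ 'd) measure" where
  "centered_normal S =
     distr std_normal_vec borel (\<lambda>z. (SOME A :: real ^ 'd ^ 'd. A ** transpose A = S) *v z)"

lemma measurable_vec_lambda_PiM:
  "(\<lambda>z. (\<chi> i. z i) :: real ^ 'd) \<in> borel_measurable (Pi\<^sub>M UNIV (\<lambda>_. std_normal_distribution))"
proof (subst borel_measurable_euclidean_space, intro ballI)
  fix b :: "real ^ 'd" assume "b \<in> Basis"
  then obtain i where b: "b = axis i 1" by (auto simp: Basis_vec_def)
  have "(\<lambda>z. z i) \<in> measurable (Pi\<^sub>M UNIV (\<lambda>_. std_normal_distribution)) std_normal_distribution"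
    by (rule measurable_component_singleton) simp
  then show "(\<lambda>z. (\<chi> i. z i) \<bullet> b) \<in> borel_measurable (Pi\<^sub>M UNIV (\<lambda>_. std_normal_distribution))"
    by (simp add: b inner_axis)
qed

lemma measurable_matrix_vector_mult: "(\<lambda>z. (A :: real ^ 'd ^ 'e) *v z) \<in> borel_measurable borel"
  by (intro borel_measurable_continuous_onI linear_continuous_on) (simp add: linear_linear)

lemma prob_space_centered_normal:
  fixes S :: "real ^ 'd ^ 'd"
  shows "prob_space (centered_normal S)"
proof -
  have "prob_space (std_normal_vec :: (real ^ 'd) measure)"
    unfolding std_normal_vec_def
    by (intro prob_space.prob_space_distr measurable_vec_lambda_PiM prob_space_PiM
        prob_space_normal_density) simp
  then show ?thesis unfolding centered_normal_def
    by (rule prob_space.prob_space_distr)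
       (simp add: std_normal_vec_def measurable_matrix_vector_mult)
qed

lemma ex_matrix_root:
  fixes S :: "real ^ 'd ^ 'd"
  assumes "transpose S = S" and "\<And>x. 0 \<le> x \<bullet> (S *v x)"
  shows "\<exists>A :: real ^ 'd ^ 'd. A ** transpose A = S"
proof -
  have *: "\<exists>A :: real ^ 'd ^ 'd. A ** transpose A = S \<and> (\<forall>i j. j \<notin> I \<longrightarrow> A $ i $ j = 0)"
    if "finite I" "transpose S = S" "\<And>x. 0 \<le> x \<bullet> (S *v x)" "\<And>i j. j \<notin> I \<Longrightarrow> S $ i $ j = 0"
    for I and S :: "real ^ 'd ^ 'd"
    using that
  proof (induction I arbitrary: S rule: finite_induct)
    case empty
    then have "S = 0" by (simp add: vec_eq_iff)
    then show ?case by (intro exI[of _ 0]) (simp add: vec_eq_iff matrix_matrix_mult_def)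
  next
    case (insert k I)
    have sym: "S $ i $ j = S $ j $ i" for i j
      using insert.prems(1) by (metis transpose_def vec_lambda_beta)
    have expand: "(x + t *\<^sub>R axis k 1) \<bullet> (S *v (x + t *\<^sub>R axis k 1)) =
        x \<bullet> (S *v x) + 2 * t * (S *v x) $ k + t\<^sup>2 * S $ k $ k" for x t
    proof -
      have "x \<bullet> (S *v axis k 1) = (S *v x) $ k"
        using insert.prems(1)
        by (metis dot_lmul_matrix inner_axis inner_real_def mult.right_neutral vector_transpose_matrix)
      moreover have "axis k 1 \<bullet> (S *v y) = (S *v y) $ k" for y
        by (simp add: inner_axis')
      moreover have "(S *v axis k 1) $ k = S $ k $ k"
        by (simp add: matrix_vector_mult_basis column_def)
      ultimately show ?thesis
        by (simp add: matrix_vector_right_distrib matrix_vector_mult_scaleR inner_add_left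
            inner_add_right power2_eq_square algebra_simps)
    qed
    define s where "s = S $ k $ k"
    have s0: "0 \<le> s"
      using insert.prems(2)[of "axis k 1"]
      by (simp add: s_def inner_axis' matrix_vector_mult_basis column_def)
    show ?case
    proof (cases "s = 0")
      case True
      have "(S *v x) $ k = 0" for x
      proof (rule ccontr)
        assume n: "(S *v x) $ k \<noteq> 0"
        let ?t = "- (x \<bullet> (S *v x) + 1) / (2 * (S *v x) $ k)"
        have "0 \<le> x \<bullet> (S *v x) + 2 * ?t * (S *v x) $ k"
          using insert.prems(2)[of "x + ?t *\<^sub>R axis k 1"] True unfolding expand s_def by simp
        with n show False by (simp add: field_simps)
      qed
      then have "S $ k $ i = 0" for i
        by (metis column_def matrix_vector_mult_basis vec_lambda_beta)
      then have "S $ i $ j = 0" if "j \<notin> I" for i j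
        using insert.prems(3) that sym by (metis insertE)
      then obtain A where "A ** transpose A = S" "\<And>i j. j \<notin> I \<Longrightarrow> A $ i $ j = 0"
        using insert.IH[of S] insert.prems by blast
      then show ?thesis by (intro exI[of _ A]) auto
    next
      case False
      with s0 have s: "s > 0" by simp
      define S' where "S' = (\<chi> i j. S $ i $ j - S $ i $ k * S $ k $ j / s)"
      have S'v: "S' *v x = S *v x - ((S *v x) $ k / s) *\<^sub>R (S *v axis k 1)" for x
      proof -
        have "(S' *v x) $ i = (S *v x) $ i - (S *v x) $ k / s * S $ i $ k" for i
          by (simp add: S'_def matrix_vector_mult_def sum_subtractf sum_divide_distrib
              sum_distrib_left sum_distrib_right algebra_simps)
        then show ?thesis by (simp add: vec_eq_iff matrix_vector_mult_basis column_def)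
      qed
      have "transpose S' = S'"
        by (simp add: S'_def vec_eq_iff transpose_def sym mult.commute)
      moreover have "0 \<le> x \<bullet> (S' *v x)" for x
      proof -
        have "x \<bullet> (S *v axis k 1) = (S *v x) $ k"
          using insert.prems(1)
          by (metis dot_lmul_matrix inner_axis inner_real_def mult.right_neutral vector_transpose_matrix)
        then have "x \<bullet> (S' *v x) = x \<bullet> (S *v x) - ((S *v x) $ k)\<^sup>2 / s"
          unfolding S'v by (simp add: inner_diff_right power2_eq_square)
        also have "\<dots> = (x + (- (S *v x) $ k / s) *\<^sub>R axis k 1) \<bullet> (S *v (x + (- (S *v x) $ k / s) *\<^sub>R axis k 1))"
          unfolding expand s_def[symmetric] using s by (simp add: power2_eq_square field_simps)
        finally show ?thesis using insert.prems(2) by simp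
      qed
      moreover have "S' $ i $ j = 0" if "j \<notin> I" for i j
      proof (cases "j = k")
        case True
        then show ?thesis using s by (simp add: S'_def s_def)
      next
        case False
        then show ?thesis using insert.prems(3) that by (simp add: S'_def)
      qed
      ultimately obtain A where A: "A ** transpose A = S'" "\<And>i j. j \<notin> I \<Longrightarrow> A $ i $ j = 0"
        using insert.IH[of S'] by blast
      define B where "B = (\<chi> i j. if j = k then S $ i $ k / sqrt s else A $ i $ j)"
      have "(B ** transpose B) $ i $ j = S $ i $ j" for i j
      proof -
        have "(B ** transpose B) $ i $ j = (\<Sum>l\<in>UNIV. B $ i $ l * B $ j $ l)"
          by (simp add: matrix_matrix_mult_def transpose_def)
        also have "\<dots> = S $ i $ k * S $ j $ k / s + (\<Sum>l\<in>UNIV - {k}. B $ i $ l * B $ j $ l)"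
          using s by (subst sum.remove[of _ k]) (auto simp: B_def)
        also have "(\<Sum>l\<in>UNIV - {k}. B $ i $ l * B $ j $ l) = (\<Sum>l\<in>UNIV. A $ i $ l * A $ j $ l)"
          using A(2)[OF insert.hyps(2)] by (subst (2) sum.remove[of _ k]) (auto simp: B_def)
        also have "\<dots> = (A ** transpose A) $ i $ j"
          by (simp add: matrix_matrix_mult_def transpose_def)
        finally show ?thesis unfolding A(1) using sym[of k j] by (simp add: S'_def)
      qed
      then have "B ** transpose B = S" by (simp add: vec_eq_iff)
      moreover have "\<forall>i j. j \<notin> insert k I \<longrightarrow> B $ i $ j = 0" using A(2) by (simp add: B_def)
      ultimately show ?thesis by blast
    qed
  qed
  show ?thesis using *[of UNIV S] assms by auto
qed

lemma char_centered_normal: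
  fixes S :: "real ^ 'd ^ 'd"
  assumes "transpose S = S" and "\<And>x. 0 \<le> x \<bullet> (S *v x)"
  shows "(\<integral>x. iexp (t \<bullet> x) \<partial>centered_normal S) = exp (- (t \<bullet> (S *v t)) / 2)"
proof -
  define A :: "real ^ 'd ^ 'd" where "A = (SOME A. A ** transpose A = S)"
  have A: "A ** transpose A = S"
    unfolding A_def using ex_matrix_root[OF assms] by (rule someI_ex)
  interpret prob_space std_normal_distribution by (rule prob_space_normal_density) simp
  interpret product_sigma_finite "\<lambda>_ :: 'd. std_normal_distribution" by unfold_locales
  define u where "u = transpose A *v t"
  have tA: "t \<bullet> (A *v z) = u \<bullet> z" for z
    unfolding u_def by (metis dot_lmul_matrix vector_transpose_matrix transpose_transpose)
  have "(\<integral>x. iexp (t \<bullet> x) \<partial>centered_normal S) =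
      (\<integral>z. iexp (u \<bullet> (\<chi> i. z i)) \<partial>Pi\<^sub>M UNIV (\<lambda>_. std_normal_distribution))"
    unfolding centered_normal_def A_def[symmetric] std_normal_vec_def
    by (simp add: integral_distr measurable_vec_lambda_PiM measurable_matrix_vector_mult tA)
  also have "\<dots> = (\<integral>z. (\<Prod>i\<in>UNIV. iexp (u $ i * z i)) \<partial>Pi\<^sub>M UNIV (\<lambda>_. std_normal_distribution))"
    by (simp add: inner_vec_def sum_distrib_left exp_sum)
  also have "\<dots> = (\<Prod>i\<in>UNIV. char std_normal_distribution (u $ i))"
    unfolding char_def by (intro product_integral_prod integrable_iexp) auto
  also have "\<dots> = exp (- (u \<bullet> u) / 2)"
    by (simp add: char_std_normal_distribution inner_vec_def sum_negf sum_divide_distrib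
        power2_eq_square flip: of_real_prod exp_sum)
  also have "u \<bullet> u = t \<bullet> (S *v t)"
    unfolding tA[symmetric] by (simp add: u_def matrix_vector_mul_assoc A del: transpose_matrix_vector)
  finally show ?thesis by (simp add: exp_of_real)
qed

section \<open>Weighted random recursive trees\<close>

text \<open>The nodes are numbered by order of arrival, so that \<open>T\<^sub>n\<close> has node set \<open>{0..n}\<close> with
  root \<open>0\<close>, and the tree process is encoded by \<open>par\<close>: \<open>par n\<close> is the parent, a node of
  \<open>T\<^sub>n\<close>, of the node \<open>Suc n\<close> added to form \<open>T\<^bsub>n+1\<^esub>\<close>.  In particular \<open>T\<^sub>n\<close> is determined by
  \<open>par k\<close> for \<open>k < n\<close>.\<close>

definition node_weight :: "real \<Rightarrow> nat \<Rightarrow> real" where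
  "node_weight \<rho> v = (if v = 0 then \<rho> else 1)"

definition total_weight :: "real \<Rightarrow> nat \<Rightarrow> real" where
  "total_weight \<rho> n = (\<Sum>v\<le>n. node_weight \<rho> v)"

lemma total_weight_eq: "total_weight \<rho> n = real n + \<rho>"
  by (induction n) (simp_all add: total_weight_def node_weight_def)

text \<open>In the last conjunct, \<open>h\<close> is a history of the process up to \<open>T\<^sub>n\<close>; the conjunct says that,
  conditionally on this history, the next parent is \<open>v\<close> with probability proportional to the
  weight of \<open>v\<close>.\<close>

definition weighted_random_recursive_tree ::
    "real \<Rightarrow> 'a measure \<Rightarrow> (nat \<Rightarrow> 'a \<Rightarrow> nat) \<Rightarrow> bool" where
  "weighted_random_recursive_tree \<rho> M par \<longleftrightarrow>
     (\<forall>n. par n \<in> measurable M (count_space UNIV)) \<and>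
     (\<forall>n. \<forall>\<omega>\<in>space M. par n \<omega> \<le> n) \<and>
     (\<forall>n h. \<forall>v\<le>n.
        measure M {\<omega> \<in> space M. (\<forall>k<n. par k \<omega> = h k) \<and> par n \<omega> = v} =
        node_weight \<rho> v / total_weight \<rho> n * measure M {\<omega> \<in> space M. \<forall>k<n. par k \<omega> = h k})"

section \<open>Branching random walks\<close>

definition indep_of_tree ::
    "'a measure \<Rightarrow> (nat \<Rightarrow> 'a \<Rightarrow> 'v::topological_space) \<Rightarrow> (nat \<Rightarrow> 'a \<Rightarrow> nat) \<Rightarrow> bool" where
  "indep_of_tree M \<eta> par \<longleftrightarrow>
     prob_space.indep_set M
       (sets (vimage_algebra (space M) (\<lambda>\<omega> v. \<eta> v \<omega>) (Pi\<^sub>M UNIV (\<lambda>_. borel))))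
       (sets (vimage_algebra (space M) (\<lambda>\<omega> n. par n \<omega>) (Pi\<^sub>M UNIV (\<lambda>_. count_space UNIV))))"

text \<open>\<open>\<eta>\<^sub>0\<close> belongs to the root; as usual it is part of the family but plays no role in the walk.\<close>

definition branching_random_walk ::
    "'a measure \<Rightarrow> (nat \<Rightarrow> 'a \<Rightarrow> nat) \<Rightarrow> 'v::real_normed_vector measure \<Rightarrow>
     (nat \<Rightarrow> 'a \<Rightarrow> 'v) \<Rightarrow> (nat \<Rightarrow> 'a \<Rightarrow> 'v) \<Rightarrow> bool" where
  "branching_random_walk M par \<L> \<eta> X \<longleftrightarrow>
     prob_space.indep_vars M (\<lambda>_. borel) \<eta> UNIV \<and>
     (\<forall>v. distr M borel (\<eta> v) = \<L>) \<and>
     indep_of_tree M \<eta> par \<and>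
     (\<forall>\<omega>\<in>space M. X 0 \<omega> = 0) \<and>
     (\<forall>n. \<forall>\<omega>\<in>space M. X (Suc n) \<omega> = X (par n \<omega>) \<omega> + \<eta> (Suc n) \<omega>)"

text \<open>The empirical distribution for given positions \<open>x\<close> of the nodes: the image under \<open>x\<close> of the
  measure on \<open>{0..n}\<close> with mass \<open>node_weight \<rho> v / total_weight \<rho> n\<close> at \<open>v\<close>.\<close>

definition empirical_dist :: "real \<Rightarrow> nat \<Rightarrow> (nat \<Rightarrow> 'v::topological_space) \<Rightarrow> 'v measure" where
  "empirical_dist \<rho> n x =
     distr (point_measure {..n} (\<lambda>v. ennreal (node_weight \<rho> v / total_weight \<rho> n))) borel x"

lemma emeasure_empirical_dist:
  assumes "\<rho> > 0" "B \<in> sets borel"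
  shows "emeasure (empirical_dist \<rho> n x) B =
    ennreal (1 / total_weight \<rho> n * (\<Sum>v\<le>n. node_weight \<rho> v * indicator B (x v)))"
proof -
  have "emeasure (empirical_dist \<rho> n x) B =
      (\<Sum>v\<in>x -` B \<inter> {..n}. ennreal (node_weight \<rho> v / total_weight \<rho> n))"
    unfolding empirical_dist_def using assms
    by (simp add: emeasure_distr space_point_measure emeasure_point_measure_finite)
  also have "\<dots> = ennreal (\<Sum>v\<in>x -` B \<inter> {..n}. node_weight \<rho> v / total_weight \<rho> n)"
    using assms by (intro sum_ennreal) (auto simp: node_weight_def total_weight_eq)
  also have "(\<Sum>v\<in>x -` B \<inter> {..n}. node_weight \<rho> v / total_weight \<rho> n) =
      (\<Sum>v\<le>n. node_weight \<rho> v * indicator B (x v) / total_weight \<rho> n)"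
    by (intro sum.mono_neutral_cong_left) (auto simp: indicator_def)
  also have "\<dots> = 1 / total_weight \<rho> n * (\<Sum>v\<le>n. node_weight \<rho> v * indicator B (x v))"
    by (simp only: sum_distrib_left) (simp add: mult.commute)
  finally show ?thesis .
qed

end

theory Submission
  imports Defs "HOL-Real_Asymp.Real_Asymp"
begin

text \<open>
  Fix a frequency \<open>t\<close>, let \<open>\<phi>(t) = E exp(i t \<bullet> \<eta>)\<close>, and let \<open>A\<^sub>n(t)\<close> be the characteristic function of the
  empirical distribution at \<open>t\<close>.  The parents and the offsets are all independent, whence
  \<open>E A\<^sub>n = q\<^sub>n\<close> with \<open>q\<^sub>n = \<Prod>\<^bsub>i<n\<^esub> (1 - (1 - \<phi>(t)) / (i + 1 + \<rho>))\<close>, and \<open>A\<^sub>n / q\<^sub>n\<close> is a martingale.  Its variance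
  is \<open>O(\<bar>1 - \<phi>(t)\<bar>)\<close> uniformly in \<open>n\<close>, so the maximal inequality bounds
  \<open>P(sup\<^sub>n \<bar>A\<^sub>n(t) - q\<^sub>n(t)\<bar> \<ge> e)\<close> by a multiple of \<open>\<bar>t\<bar> / e\<^sup>2\<close>.  Along the frequencies \<open>s / j\<^sup>2\<close> these bounds
  are summable, so by Borel--Cantelli \<open>A\<^sub>n - q\<^sub>n \<rightarrow> 0\<close> at \<open>s / j\<^sup>2\<close> when \<open>j = j(n)\<close> tends to infinity with \<open>n\<close>.
  With \<open>j(n) = \<lfloor>(log n)\<^sup>1\<^sup>/\<^sup>4\<rfloor>\<close> one has \<open>j(n)\<^sup>2 \<sim> (log n)\<^sup>1\<^sup>/\<^sup>2\<close>, and \<open>q\<^sub>n \<approx> exp(- (1 - \<phi>) log n)\<close> yields the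
  Gaussian limit after centering.  Changing the grid_scale from \<open>j(n)\<^sup>2\<close> to \<open>(log n)\<^sup>1\<^sup>/\<^sup>2\<close> does not affect the limit.

  The exceptional null set depends on the frequency.  Almost surely, convergence holds at all
  rational frequencies and, by Fubini's theorem, at almost all frequencies on the coordinate axes.
  The latter gives tightness, and the former then suffices for weak convergence.
\<close>

section \<open>Weak convergence from characteristic functions\<close>

inductive trig_polynomial :: "(real ^ 'd) set \<Rightarrow> (real ^ 'd \<Rightarrow> complex) \<Rightarrow> bool" for U where
  monomial: "u \<in> U \<Longrightarrow> trig_polynomial U (\<lambda>x. c * iexp (u \<bullet> x))"
| add: "trig_polynomial U f \<Longrightarrow> trig_polynomial U g \<Longrightarrow> trig_polynomial U (\<lambda>x. f x + g x)"

lemma trig_polynomial_mult: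
  assumes U: "\<And>u v. u \<in> U \<Longrightarrow> v \<in> U \<Longrightarrow> u + v \<in> U"
    and "trig_polynomial U f" "trig_polynomial U g"
  shows "trig_polynomial U (\<lambda>x. f x * g x)"
  using assms(2)
proof (induction rule: trig_polynomial.induct)
  case (monomial u c)
  show ?case
    using assms(3)
  proof (induction rule: trig_polynomial.induct)
    case (monomial v d)
    have "(\<lambda>x. c * iexp (u \<bullet> x) * (d * iexp (v \<bullet> x))) = (\<lambda>x. (c * d) * iexp ((u + v) \<bullet> x))"
      by (simp add: inner_add_left exp_add distrib_left mult_ac)
    then show ?case
      using trig_polynomial.monomial[of "u + v" U "c * d"] U \<open>u \<in> U\<close> monomial by simp
  next
    case (add f g)
    then show ?case using trig_polynomial.add by (simp add: distrib_left)
  qed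
next
  case (add f g)
  then show ?case using trig_polynomial.add by (simp add: distrib_right)
qed

lemma trig_polynomial_sum:
  assumes "0 \<in> U" "finite I" "\<And>i. i \<in> I \<Longrightarrow> trig_polynomial U (f i)"
  shows "trig_polynomial U (\<lambda>x. \<Sum>i\<in>I. f i x)"
  using assms(2,3)
proof (induction I rule: finite_induct)
  case empty
  then show ?case using trig_polynomial.monomial[OF assms(1), of 0] by simp
next
  case (insert i I)
  then show ?case using trig_polynomial.add[of U "f i" "\<lambda>x. \<Sum>i\<in>I. f i x"] by simp
qed

text \<open>Euler's formula writes each sine as two exponentials with frequencies
  \<open>axis i r\<close> and \<open>axis i (- r)\<close>; sums and products of these stay
  trigonometric polynomials because \<open>U\<close> is closed under addition.\<close>

lemma trig_polynomial_polynomial_sin: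
  fixes p :: "real ^ 'd \<Rightarrow> real"
  assumes p: "real_polynomial_function p"
    and U: "\<And>u v. u \<in> U \<Longrightarrow> v \<in> U \<Longrightarrow> u + v \<in> U" "0 \<in> U"
      "\<And>i. axis i r \<in> U" "\<And>i. axis i (- r) \<in> U"
  shows "trig_polynomial U (\<lambda>x. of_real (p (\<chi> i. sin (r * x $ i))))"
  using p
proof (induction rule: real_polynomial_function.induct)
  case (linear f)
  have "of_real (f (\<chi> i. sin (r * x $ i))) =
      (\<Sum>i\<in>UNIV. (f (axis i 1) / (2 * \<i>)) * iexp (axis i r \<bullet> x) +
          (- f (axis i 1) / (2 * \<i>)) * iexp (axis i (- r) \<bullet> x))" for x
  proof -
    have "(\<chi> i. sin (r * x $ i)) = (\<Sum>i\<in>UNIV. sin (r * x $ i) *\<^sub>R axis i (1::real))"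
      by (simp add: vec_eq_iff axis_def if_distrib cong: if_cong)
    then have "f (\<chi> i. sin (r * x $ i)) = (\<Sum>i\<in>UNIV. sin (r * x $ i) * f (axis i 1))"
      using linear by (simp add: linear_sum linear_cmul bounded_linear.linear)
    moreover have "of_real (sin (r * x $ i) * f (axis i 1)) =
        (f (axis i 1) / (2 * \<i>)) * iexp (axis i r \<bullet> x) +
          (- f (axis i 1) / (2 * \<i>)) * iexp (axis i (- r) \<bullet> x)" for i
      by (simp add: inner_axis' sin_of_real[symmetric] sin_exp_eq diff_divide_distrib mult_ac
          right_diff_distrib)
    ultimately show ?thesis by simp
  qed
  then show ?case
    by (simp only:) (intro trig_polynomial_sum trig_polynomial.intros U finite)
next
  case (const c)
  then show ?case using trig_polynomial.monomial[OF U(2), of "of_real c"] by simp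
next
  case (add f g)
  then show ?case using trig_polynomial.add by fastforce
next
  case (mult f g)
  then show ?case using trig_polynomial_mult[OF U(1)] by fastforce
qed

text \<open>The frequency set \<open>U\<close> stays explicit because null sets can be combined only
  over countably many frequencies; \<open>U\<close> will be the set of rational vectors.\<close>

lemma integral_trig_polynomial_tendsto:
  fixes \<mu> :: "nat \<Rightarrow> (real ^ 'd) measure"
  assumes \<mu>: "\<And>n. prob_space (\<mu> n)" "\<And>n. sets (\<mu> n) = sets borel"
    and \<nu>: "prob_space \<nu>" "sets \<nu> = sets borel"
    and char: "\<And>u. u \<in> U \<Longrightarrow> (\<lambda>n. \<integral>x. iexp (u \<bullet> x) \<partial>\<mu> n) \<longlonglongrightarrow> (\<integral>x. iexp (u \<bullet> x) \<partial>\<nu>)"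
    and g: "trig_polynomial U g"
  shows "(\<lambda>n. \<integral>x. g x \<partial>\<mu> n) \<longlonglongrightarrow> (\<integral>x. g x \<partial>\<nu>)"
proof -
  have [measurable_cong]: "sets (\<mu> n) = sets borel" "sets \<nu> = sets borel" for n by fact+
  interpret \<mu>: prob_space "\<mu> n" for n by fact
  interpret \<nu>: prob_space \<nu> by fact
  have "(\<forall>n. integrable (\<mu> n) g) \<and> integrable \<nu> g \<and> (\<lambda>n. \<integral>x. g x \<partial>\<mu> n) \<longlonglongrightarrow> (\<integral>x. g x \<partial>\<nu>)"
    using g
  proof (induction rule: trig_polynomial.induct)
    case (monomial u c)
    have "integrable (\<mu> n) (\<lambda>x. iexp (u \<bullet> x))" for n
      by (rule \<mu>.integrable_const_bound[where B=1]) auto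
    moreover have "integrable \<nu> (\<lambda>x. iexp (u \<bullet> x))"
      by (rule \<nu>.integrable_const_bound[where B=1]) auto
    ultimately show ?case
      using char[OF monomial] by (auto intro!: tendsto_intros)
  next
    case (add f g)
    then show ?case by (auto intro: tendsto_add)
  qed
  then show ?thesis by blast
qed

text \<open>Serves to exchange test functions: an error of \<open>d\<close> on a ball and of
  \<open>d + C\<close> off it costs little once the mass outside the ball is small.\<close>

lemma integral_diff_le_tail:
  fixes f g :: "'v :: euclidean_space \<Rightarrow> real"
  assumes "prob_space M" "sets M = sets borel"
    and f: "f \<in> borel_measurable borel" and g: "g \<in> borel_measurable borel"
    and fB: "\<And>x. \<bar>f x\<bar> \<le> B" and gB: "\<And>x. \<bar>g x\<bar> \<le> B'"
    and fg: "\<And>x. \<bar>f x - g x\<bar> \<le> d + C * indicator {x. K < norm x} x"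
  shows "\<bar>integral\<^sup>L M f - integral\<^sup>L M g\<bar> \<le> d + C * measure M {x. K < norm x}"
proof -
  interpret M: prob_space M by fact
  have [measurable_cong]: "sets M = sets borel" by fact
  have sp: "space M = UNIV" using sets_eq_imp_space_eq[OF assms(2)] by simp
  have fi: "integrable M f" using fB f by (intro M.integrable_const_bound[where B=B]) auto
  have gi: "integrable M g" using gB g by (intro M.integrable_const_bound[where B=B']) auto
  have ii: "integrable M (\<lambda>x. C * indicator {x. K < norm x} x)"
    by (intro integrable_mult_right integrable_real_indicator) (auto simp: M.emeasure_eq_measure)
  have "\<bar>integral\<^sup>L M f - integral\<^sup>L M g\<bar> = \<bar>\<integral>x. f x - g x \<partial>M\<bar>"
    using fi gi by simp
  also have "\<dots> \<le> (\<integral>x. \<bar>f x - g x\<bar> \<partial>M)"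
    by (rule integral_abs_bound)
  also have "\<dots> \<le> (\<integral>x. d + C * indicator {x. K < norm x} x \<partial>M)"
    using fi gi ii by (intro integral_mono fg) auto
  also have "\<dots> = d + C * measure M {x. K < norm x}"
    using ii M.prob_space by (simp add: sp)
  finally show ?thesis .
qed

text \<open>By tightness a test function matters only on a ball, where Stone--Weierstrass replaces
  it by a polynomial in the sines of \<open>x $ i / k\<close>. This is a trigonometric polynomial
  bounded on the whole space, so the error outside the ball is again controlled by
  tightness.\<close>

lemma weakly_converges_of_char:
  fixes \<mu> :: "nat \<Rightarrow> (real ^ 'd) measure"
  assumes \<mu>: "\<And>n. prob_space (\<mu> n)" "\<And>n. sets (\<mu> n) = sets borel"
    and \<nu>: "prob_space \<nu>" "sets \<nu> = sets borel"
    and char: "\<And>u. (\<And>i. u $ i \<in> \<rat>) \<Longrightarrow>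
      (\<lambda>n. \<integral>x. iexp (u \<bullet> x) \<partial>\<mu> n) \<longlonglongrightarrow> (\<integral>x. iexp (u \<bullet> x) \<partial>\<nu>)"
    and tight: "\<And>e. e > 0 \<Longrightarrow> \<exists>K. \<forall>\<^sub>F n in sequentially. measure (\<mu> n) {x. K < norm x} \<le> e"
  shows "weakly_converges \<mu> \<nu>"
  unfolding weakly_converges_def
proof (intro allI impI)
  fix f :: "real ^ 'd \<Rightarrow> real"
  assume f: "continuous_on UNIV f" and "bounded (range f)"
  then obtain B where B: "\<And>x. \<bar>f x\<bar> \<le> B" "B > 0"
    by (auto simp: bounded_pos)
  have f_meas [measurable]: "f \<in> borel_measurable borel"
    using f by (rule borel_measurable_continuous_onI)
  have [measurable_cong]: "sets (\<mu> n) = sets borel" "sets \<nu> = sets borel" for n by fact+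
  interpret \<mu>: prob_space "\<mu> n" for n by fact
  interpret \<nu>: prob_space \<nu> by fact
  show "(\<lambda>n. integral\<^sup>L (\<mu> n) f) \<longlonglongrightarrow> integral\<^sup>L \<nu> f"
  proof (rule LIMSEQ_I, goal_cases)
    case (1 e)
    \<comment> \<open>Replacing \<open>f\<close> by \<open>g\<close> costs at most
      \<open>(2 * B + 2) * d\<close> under \<open>\<mu> n\<close> and again under
      \<open>\<nu>\<close>, and the convergence of the integrals of \<open>g\<close> costs
      \<open>d\<close>; the sum stays below \<open>(8 * B + 6) * d\<close>.\<close>
    define d where "d = e / (8 * B + 6)"
    have "d > 0" using 1 B by (simp add: d_def)
    obtain K where K: "\<forall>\<^sub>F n in sequentially. measure (\<mu> n) {x. K < norm x} \<le> d"
      using tight[OF \<open>d > 0\<close>] by blast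
    have "(\<lambda>k. measure \<nu> {x. real k < norm x}) \<longlonglongrightarrow> measure \<nu> (\<Inter>k. {x. real k < norm x})"
    proof (rule \<nu>.finite_Lim_measure_decseq)
      show "range (\<lambda>k. {x :: real ^ 'd. real k < norm x}) \<subseteq> sets \<nu>"
        unfolding \<nu>(2) by auto
      show "decseq (\<lambda>k. {x :: real ^ 'd. real k < norm x})"
        unfolding decseq_def by force
    qed
    moreover have "(\<Inter>k. {x :: real ^ 'd. real k < norm x}) = {}"
      unfolding set_eq_iff by (simp add: not_less real_arch_simple)
    ultimately have "(\<lambda>k. measure \<nu> {x. real k < norm x}) \<longlonglongrightarrow> 0" by simp
    then have "\<forall>\<^sub>F k in sequentially. measure \<nu> {x. real k < norm x} < d"
      using \<open>d > 0\<close> by (rule order_tendstoD)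
    moreover have "\<forall>\<^sub>F k in sequentially. K \<le> real k"
      using eventually_ge_at_top[of "nat \<lceil>K\<rceil>"] by eventually_elim linarith
    ultimately have "\<forall>\<^sub>F k in sequentially. measure \<nu> {x. real k < norm x} < d \<and> K \<le> real k \<and> k > 0"
      using eventually_gt_at_top[of 0] by eventually_elim simp
    then obtain k :: nat where k: "measure \<nu> {x. real k < norm x} < d" "K \<le> real k" "k > 0"
      by (blast dest: eventually_happens'[OF sequentially_bot])
    \<comment> \<open>\<open>f\<close> agrees with the periodic function \<open>h(sin(x / k))\<close> on the cube of side \<open>k \<pi>\<close> since
      \<open>k arcsin(sin(x / k)) = x\<close> there, and a polynomial in \<open>sin(x / k)\<close> is a trigonometric polynomial.\<close>
    define h where "h = (\<lambda>y :: real ^ 'd. f (\<chi> i. k * arcsin (y $ i)))"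
    let ?box = "cbox (- 1) (1 :: real ^ 'd)"
    have "continuous_on ?box (\<lambda>y :: real ^ 'd. \<chi> i. k * arcsin (y $ i))"
      by (intro continuous_on_vec_lambda continuous_intros) (auto simp: mem_box_cart)
    then have "continuous_on ?box h"
      unfolding h_def using f continuous_on_compose2 by blast
    from Stone_Weierstrass_real_polynomial_function[OF compact_cbox this \<open>d > 0\<close>]
    obtain p where p: "real_polynomial_function p" "\<And>y. y \<in> ?box \<Longrightarrow> \<bar>h y - p y\<bar> < d"
      by blast
    define g where "g = (\<lambda>x :: real ^ 'd. p (\<chi> i. sin (1 / k * x $ i)))"
    have p_meas: "p \<in> borel_measurable borel"
      by (intro borel_measurable_continuous_onI continuous_at_imp_continuous_on ballI
          continuous_real_polymonial_function p(1))
    have g_meas [measurable]: "g \<in> borel_measurable borel"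
    proof -
      have "(\<lambda>x :: real ^ 'd. \<chi> i. sin (1 / k * x $ i)) \<in> borel_measurable borel"
        by (intro borel_measurable_continuous_onI continuous_intros)
      from measurable_compose[OF this p_meas] show ?thesis by (simp add: g_def)
    qed
    have box: "(\<chi> i. sin (1 / k * x $ i)) \<in> ?box" for x :: "real ^ 'd"
      by (auto simp: mem_box_cart)
    have h_le: "\<bar>h y\<bar> \<le> B" for y unfolding h_def by (rule B)
    have g_le: "\<bar>g x\<bar> \<le> B + d" for x
      using p(2)[OF box, of x] h_le[of "\<chi> i. sin (1 / k * x $ i)"] unfolding g_def by linarith
    have fg: "\<bar>f x - g x\<bar> \<le> d + (2 * B + d) * indicator {x. real k < norm x} x" for x
    proof (cases "real k < norm x")
      case True
      then show ?thesis using g_le[of x] B(1)[of x] \<open>d > 0\<close> by simp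
    next
      case False
      have "\<bar>1 / k * x $ i\<bar> \<le> pi / 2" for i
      proof -
        have "\<bar>x $ i\<bar> \<le> k" using component_le_norm_cart[of x i] False by linarith
        then have "\<bar>1 / k * x $ i\<bar> \<le> 1" using k(3) by (simp add: abs_mult field_simps)
        then show ?thesis using pi_ge_two by linarith
      qed
      then have "arcsin (sin (1 / k * x $ i)) = 1 / k * x $ i" for i
        by (intro arcsin_sin) (metis abs_le_iff minus_le_iff, metis abs_le_iff)
      then have "k * arcsin (sin (1 / k * x $ i)) = x $ i" for i
        using k(3) by simp
      then have "f x = h (\<chi> i. sin (1 / k * x $ i))"
        unfolding h_def by simp
      then show ?thesis using p(2)[OF box, of x] False unfolding g_def by simp
    qed
    \<comment> \<open>Since \<open>k\<close> is an integer, the frequencies \<open>1 / k\<close>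
      along the axes are rational, and rational vectors are closed under addition.\<close>
    have "trig_polynomial {u. \<forall>i. u $ i \<in> \<rat>} (\<lambda>x. complex_of_real (g x))"
      unfolding g_def
      by (rule trig_polynomial_polynomial_sin[OF p(1)]) (auto simp: axis_def)
    from integral_trig_polynomial_tendsto[OF \<mu> \<nu> _ this] char
    have "(\<lambda>n. \<integral>x. complex_of_real (g x) \<partial>\<mu> n) \<longlonglongrightarrow> (\<integral>x. complex_of_real (g x) \<partial>\<nu>)"
      by simp
    then have "(\<lambda>n. \<integral>x. g x \<partial>\<mu> n) \<longlonglongrightarrow> (\<integral>x. g x \<partial>\<nu>)"
      by (simp add: tendsto_of_real_iff)
    then have "\<forall>\<^sub>F n in sequentially. dist (\<integral>x. g x \<partial>\<mu> n) (\<integral>x. g x \<partial>\<nu>) < d"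
      using \<open>d > 0\<close> by (rule tendstoD)
    with K have "\<forall>\<^sub>F n in sequentially. norm (integral\<^sup>L (\<mu> n) f - integral\<^sup>L \<nu> f) < e"
    proof eventually_elim
      case (elim n)
      have "measure (\<mu> n) {x. real k < norm x} \<le> measure (\<mu> n) {x. K < norm x}"
        using k(2) by (intro \<mu>.finite_measure_mono) auto
      then have *: "measure (\<mu> n) {x. real k < norm x} \<le> d" using elim by linarith
      \<comment> \<open>The tail mass \<open>m\<close> is bounded by \<open>d\<close> against the
        coefficient \<open>2 * B\<close>, and by 1 against the coefficient \<open>d\<close>.\<close>
      have mult: "(2 * B + d) * m \<le> (2 * B + 1) * d" if "m \<le> d" "m \<le> 1" "0 \<le> m" for m
      proof -
        have "2 * B * m \<le> 2 * B * d" "d * m \<le> d * 1"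
          using that B \<open>d > 0\<close> by (auto intro!: mult_left_mono)
        then show ?thesis by (simp add: algebra_simps)
      qed
      have "\<bar>integral\<^sup>L (\<mu> n) f - integral\<^sup>L (\<mu> n) g\<bar> \<le> d + (2 * B + 1) * d"
        using integral_diff_le_tail[OF \<mu>(1)[of n] \<mu>(2)[of n] f_meas g_meas B(1) g_le fg] mult[OF * \<mu>.prob_le_1 measure_nonneg] by linarith
      moreover have "\<bar>integral\<^sup>L \<nu> f - integral\<^sup>L \<nu> g\<bar> \<le> d + (2 * B + 1) * d"
        using integral_diff_le_tail[OF \<nu> f_meas g_meas B(1) g_le fg] mult[OF less_imp_le[OF k(1)] \<nu>.prob_le_1 measure_nonneg] by linarith
      moreover have "\<bar>integral\<^sup>L (\<mu> n) g - integral\<^sup>L \<nu> g\<bar> < d"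
        using elim by (simp add: dist_real_def)
      moreover have "d + (2 * B + 1) * d + (d + (2 * B + 1) * d) + d < (8 * B + 6) * d"
        using mult_pos_pos[OF B(2) \<open>d > 0\<close>] \<open>d > 0\<close> by (simp add: algebra_simps)
      moreover have "(8 * B + 6) * d = e" using B by (simp add: d_def)
      ultimately show ?case unfolding real_norm_def by linarith
    qed
    then show ?case by (simp only: eventually_sequentially)
  qed
qed

text \<open>Convergence at all rational frequencies would not imply tightness: consider point masses at
  \<open>2 \<pi> n!\<close>.\<close>

lemma tight_of_AE_char:
  fixes \<mu> :: "nat \<Rightarrow> (real ^ 'd) measure" and q :: "'d \<Rightarrow> real"
  assumes \<mu>: "\<And>n. prob_space (\<mu> n)" "\<And>n. sets (\<mu> n) = sets borel"
    and q: "\<And>i. 0 \<le> q i"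
    and char: "\<And>i k. 0 < k \<Longrightarrow> AE u in std_normal_distribution.
      (\<lambda>n. \<integral>x. iexp (axis i (u / real k) \<bullet> x) \<partial>\<mu> n) \<longlonglongrightarrow> of_real (exp (- ((u / real k)\<^sup>2 * q i / 2)))"
    and "e > 0"
  shows "\<exists>K. \<forall>\<^sub>F n in sequentially. measure (\<mu> n) {x. K < norm x} \<le> e"
proof -
  have [measurable_cong]: "sets (\<mu> n) = sets borel" for n by fact
  have sp: "space (\<mu> n) = UNIV" for n using sets_eq_imp_space_eq[OF \<mu>(2)] by simp
  interpret \<mu>: prob_space "\<mu> n" for n by fact
  let ?\<gamma> = std_normal_distribution
  interpret \<gamma>: real_distribution ?\<gamma> by (rule real_dist_normal_dist)
  have coord: "\<exists>K. \<forall>\<^sub>F n in sequentially. measure (\<mu> n) {x. K < \<bar>x $ i\<bar>} \<le> d" if "d > 0" for i d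
  proof -
    \<comment> \<open>Averaging the characteristic function along an axis over a Gaussian frequency
      gives \<open>G k n\<close>, the mean under \<open>\<mu> n\<close> of a Gaussian bump of width
      \<open>k\<close> in coordinate \<open>i\<close>; \<open>g k\<close> is the same average of the
      limit and is close to 1 for large \<open>k\<close>.\<close>
    define g where "g k = (\<integral>u. exp (- ((u / real k)\<^sup>2 * q i / 2)) \<partial>?\<gamma>)" for k
    define G where "G k n = (\<integral>x. exp (- (x $ i / real k)\<^sup>2 / 2) \<partial>\<mu> n)" for k n
    have "g \<longlonglongrightarrow> (\<integral>u. 1 \<partial>?\<gamma>)"
      unfolding g_def
    proof (rule integral_dominated_convergence[where w="\<lambda>_. 1"])
      have "(\<lambda>k. exp (- ((u / real k)\<^sup>2 * q i / 2))) \<longlonglongrightarrow> exp (- (0\<^sup>2 * q i / 2))" for u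
        by (intro tendsto_intros lim_const_over_n) auto
      then show "AE u in ?\<gamma>. (\<lambda>k. exp (- ((u / real k)\<^sup>2 * q i / 2))) \<longlonglongrightarrow> 1" by simp
    qed (auto simp: q)
    then have "g \<longlonglongrightarrow> 1" using \<gamma>.prob_space by simp
    then have "\<forall>\<^sub>F k in sequentially. 1 - d / 2 < g k"
      using \<open>d > 0\<close> by (intro order_tendstoD) auto
    then have "\<forall>\<^sub>F k in sequentially. 1 - d / 2 < g k \<and> k > 0"
      using eventually_gt_at_top[of 0] by eventually_elim simp
    then obtain k where k: "1 - d / 2 < g k" "k > 0"
      by (blast dest: eventually_happens'[OF sequentially_bot])
    \<comment> \<open>The bump is itself the characteristic function of a standard normal law, so
      Fubini's theorem exchanges the two averages.\<close>
    have G: "of_real (G k n) = (\<integral>u. (\<integral>x. iexp (axis i (u / real k) \<bullet> x) \<partial>\<mu> n) \<partial>?\<gamma>)" for n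
    proof -
      interpret pair_prob_space "\<mu> n" ?\<gamma> ..
      have *: "of_real (exp (- (x $ i / real k)\<^sup>2 / 2)) = (\<integral>u. iexp (axis i (u / real k) \<bullet> x) \<partial>?\<gamma>)" for x
        using fun_cong[OF char_std_normal_distribution, of "x $ i / real k"]
        by (simp add: char_def inner_axis' mult_ac)
      have "complex_of_real (G k n) = (\<integral>x. of_real (exp (- (x $ i / real k)\<^sup>2 / 2)) \<partial>\<mu> n)"
        unfolding G_def by (rule integral_complex_of_real[symmetric])
      also have "\<dots> = (\<integral>x. (\<integral>u. iexp (axis i (u / real k) \<bullet> x) \<partial>?\<gamma>) \<partial>\<mu> n)"
        by (simp only: *)
      also have "\<dots> = (\<integral>u. (\<integral>x. iexp (axis i (u / real k) \<bullet> x) \<partial>\<mu> n) \<partial>?\<gamma>)"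
      proof (rule Fubini_integral[symmetric])
        have "(\<lambda>z. z $ i) \<in> borel_measurable (borel :: (real ^ 'd) measure)"
          by (intro borel_measurable_continuous_onI continuous_intros)
        then have "(\<lambda>(x, u). iexp (axis i (u / real k) \<bullet> x)) \<in> borel_measurable (\<mu> n \<Otimes>\<^sub>M ?\<gamma>)"
          unfolding inner_axis' by measurable
        then show "integrable (\<mu> n \<Otimes>\<^sub>M ?\<gamma>) (\<lambda>(x, u). iexp (axis i (u / real k) \<bullet> x))"
          by (intro integrable_const_bound[where B=1]) auto
      qed
      finally show ?thesis .
    qed
    have "(\<lambda>n. \<integral>u. (\<integral>x. iexp (axis i (u / real k) \<bullet> x) \<partial>\<mu> n) \<partial>?\<gamma>) \<longlonglongrightarrow>
        (\<integral>u. of_real (exp (- ((u / real k)\<^sup>2 * q i / 2))) \<partial>?\<gamma>)"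
    \<comment> \<open>Dominated convergence asks for convergence at almost every frequency only,
      which is what \<open>char\<close> supplies.\<close>
    proof (rule integral_dominated_convergence[where w="\<lambda>_. 1"])
      fix n
      have "(\<lambda>z. z $ i) \<in> borel_measurable (borel :: (real ^ 'd) measure)"
        by (intro borel_measurable_continuous_onI continuous_intros)
      then show "(\<lambda>u. \<integral>x. iexp (axis i (u / real k) \<bullet> x) \<partial>\<mu> n) \<in> borel_measurable ?\<gamma>"
        unfolding inner_axis' by measurable
      have "norm (\<integral>x. iexp (axis i (u / real k) \<bullet> x) \<partial>\<mu> n) \<le> (\<integral>x. norm (iexp (axis i (u / real k) \<bullet> x)) \<partial>\<mu> n)" for u
        by (rule integral_norm_bound)
      then show "AE u in ?\<gamma>. norm (\<integral>x. iexp (axis i (u / real k) \<bullet> x) \<partial>\<mu> n) \<le> 1"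
        using \<mu>.prob_space by simp
    qed (use char[OF \<open>k > 0\<close>] in auto)
    then have "(\<lambda>n. complex_of_real (G k n)) \<longlonglongrightarrow> complex_of_real (g k)"
      unfolding G g_def by simp
    then have "G k \<longlonglongrightarrow> g k"
      by (simp only: tendsto_of_real_iff)
    then have "\<forall>\<^sub>F n in sequentially. 1 - d / 2 < G k n"
      using k(1) by (rule order_tendstoD)
    then have "\<forall>\<^sub>F n in sequentially. measure (\<mu> n) {x. 2 * k < \<bar>x $ i\<bar>} \<le> d"
    proof eventually_elim
      case (elim n)
      have [measurable]: "(\<lambda>z. z $ i) \<in> borel_measurable (borel :: (real ^ 'd) measure)"
        by (intro borel_measurable_continuous_onI continuous_intros)
      have int: "integrable (\<mu> n) (\<lambda>x. exp (- (x $ i / real k)\<^sup>2 / 2))"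
        by (rule \<mu>.integrable_const_bound[where B=1]) auto
      \<comment> \<open>Outside the slab the bump is at most \<open>exp (- 2)\<close>, which is
        below 1/2 because \<open>exp 2 \<ge> 3\<close>, so twice its deficit from 1 dominates the
        indicator.\<close>
      have ind: "indicator {x. 2 * k < \<bar>x $ i\<bar>} x \<le> 2 * (1 - exp (- (x $ i / real k)\<^sup>2 / 2))" for x :: "real ^ 'd"
      proof (cases "2 * k < \<bar>x $ i\<bar>")
        case True
        then have "2 \<le> \<bar>x $ i / real k\<bar>" using k(2) by (simp add: field_simps)
        then have "2\<^sup>2 \<le> (x $ i / real k)\<^sup>2" by (subst (2) power2_abs[symmetric], intro power_mono) auto
        then have "exp (- (x $ i / real k)\<^sup>2 / 2) \<le> exp (- 2)" by simp
        also have "exp (- 2) \<le> (1 / 2 :: real)"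
          using exp_ge_add_one_self[of 2] by (simp add: exp_minus field_simps)
        finally show ?thesis using True by simp
      qed simp
      have "measure (\<mu> n) {x. 2 * k < \<bar>x $ i\<bar>} = (\<integral>x. indicator {x. 2 * k < \<bar>x $ i\<bar>} x \<partial>\<mu> n)"
        by (simp add: sp)
      also have "\<dots> \<le> (\<integral>x. 2 * (1 - exp (- (x $ i / real k)\<^sup>2 / 2)) \<partial>\<mu> n)"
        using int by (intro integral_mono ind) (auto intro!: integrable_real_indicator simp: \<mu>.emeasure_eq_measure)
      also have "\<dots> = 2 * (1 - G k n)"
        using int \<mu>.prob_space by (simp add: G_def)
      finally show ?case using elim by simp
    qed
    then show ?thesis by blast
  qed
  \<comment> \<open>Each coordinate gets an equal share of \<open>e\<close>. A point whose norm
    exceeds the sum of the \<open>K i\<close> has a coordinate beyond its bound, as the norm is at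
    most the sum of the moduli of the coordinates.\<close>
  have "\<exists>K. \<forall>i. \<forall>\<^sub>F n in sequentially. measure (\<mu> n) {x. K i < \<bar>x $ i\<bar>} \<le> e / CARD('d)"
    using coord[of "e / CARD('d)"] \<open>e > 0\<close> by (intro choice) auto
  then obtain K where K: "\<forall>i. \<forall>\<^sub>F n in sequentially. measure (\<mu> n) {x. K i < \<bar>x $ i\<bar>} \<le> e / CARD('d)"
    by blast
  then have "\<forall>\<^sub>F n in sequentially. \<forall>i. measure (\<mu> n) {x. K i < \<bar>x $ i\<bar>} \<le> e / CARD('d)"
    by (intro eventually_all_finite) auto
  then have "\<forall>\<^sub>F n in sequentially. measure (\<mu> n) {x. sum K UNIV < norm x} \<le> e"
  proof eventually_elim
    case (elim n)
    have [measurable]: "(\<lambda>z. z $ i) \<in> borel_measurable (borel :: (real ^ 'd) measure)" for i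
      by (intro borel_measurable_continuous_onI continuous_intros)
    have "\<exists>i. K i < \<bar>x $ i\<bar>" if "sum K UNIV < norm x" for x
    proof (rule ccontr)
      assume "\<not> ?thesis"
      then have "(\<Sum>i\<in>UNIV. \<bar>x $ i\<bar>) \<le> sum K UNIV" by (intro sum_mono) (simp add: not_less)
      with that norm_le_l1_cart[of x] show False by simp
    qed
    then have "measure (\<mu> n) {x. sum K UNIV < norm x} \<le> measure (\<mu> n) (\<Union>i\<in>UNIV. {x. K i < \<bar>x $ i\<bar>})"
      by (intro \<mu>.finite_measure_mono) auto
    also have "\<dots> \<le> (\<Sum>i\<in>UNIV. measure (\<mu> n) {x. K i < \<bar>x $ i\<bar>})"
      by (intro measure_UNION_le) auto
    also have "\<dots> \<le> (\<Sum>i\<in>(UNIV :: 'd set). e / CARD('d))"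
      using elim by (intro sum_mono) auto
    finally show ?case by simp
  qed
  then show ?thesis by blast
qed

text \<open>A Slutsky argument: \<open>f\<close> is uniformly continuous on a large ball, where the
  dilation by \<open>c n\<close> moves points little, and tightness bounds the remainder. It will
  replace the integer-based normalisation by the square root of the logarithm.\<close>

lemma weakly_converges_scaleR:
  fixes \<mu> :: "nat \<Rightarrow> (real ^ 'd) measure"
  assumes weak: "weakly_converges \<mu> \<nu>"
    and \<mu>: "\<And>n. prob_space (\<mu> n)" "\<And>n. sets (\<mu> n) = sets borel"
    and tight: "\<And>e. e > 0 \<Longrightarrow> \<exists>K. \<forall>\<^sub>F n in sequentially. measure (\<mu> n) {x. K < norm x} \<le> e"
    and c: "c \<longlonglongrightarrow> 1"
  shows "weakly_converges (\<lambda>n. distr (\<mu> n) borel (\<lambda>x. c n *\<^sub>R x)) \<nu>"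
  unfolding weakly_converges_def
proof (intro allI impI)
  fix f :: "real ^ 'd \<Rightarrow> real"
  assume f: "continuous_on UNIV f" and "bounded (range f)"
  then have lim: "(\<lambda>n. integral\<^sup>L (\<mu> n) f) \<longlonglongrightarrow> integral\<^sup>L \<nu> f"
    using weak by (simp add: weakly_converges_def)
  obtain B where B: "\<And>x. \<bar>f x\<bar> \<le> B" "B > 0"
    using \<open>bounded (range f)\<close> by (auto simp: bounded_pos)
  have f_meas [measurable]: "f \<in> borel_measurable borel"
    using f by (rule borel_measurable_continuous_onI)
  have [measurable_cong]: "sets (\<mu> n) = sets borel" for n by fact
  interpret \<mu>: prob_space "\<mu> n" for n by fact
  have fc_meas: "(\<lambda>x. f (c n *\<^sub>R x)) \<in> borel_measurable borel" for n by measurable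
  have "(\<lambda>n. (\<integral>x. f (c n *\<^sub>R x) \<partial>\<mu> n) - integral\<^sup>L (\<mu> n) f) \<longlonglongrightarrow> 0"
  proof (rule LIMSEQ_I, goal_cases)
    case (1 e)
    define d where "d = e / (4 * B + 4)"
    have "d > 0" using 1 B by (simp add: d_def)
    obtain K where K: "\<forall>\<^sub>F n in sequentially. measure (\<mu> n) {x. K < norm x} \<le> d"
      using tight[OF \<open>d > 0\<close>] by blast
    \<comment> \<open>\<open>L\<close> is positive even for negative \<open>K\<close> and exceeds
      the norm of every point with \<open>norm x \<le> K\<close>; the doubled radius makes room for
      the dilated points, since \<open>\<bar>c n\<bar> \<le> 2\<close> eventually.\<close>
    define L where "L = \<bar>K\<bar> + 1"
    have "uniformly_continuous_on (cball 0 (2 * L)) f"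
      using f by (intro compact_uniformly_continuous) (auto intro: continuous_on_subset)
    then obtain r where r: "r > 0"
      "\<And>x y. x \<in> cball 0 (2 * L) \<Longrightarrow> y \<in> cball 0 (2 * L) \<Longrightarrow> dist y x < r \<Longrightarrow> dist (f y) (f x) < d"
      using \<open>d > 0\<close> unfolding uniformly_continuous_on_def by metis
    have "\<forall>\<^sub>F n in sequentially. dist (c n) 1 < min 1 (r / L)"
      using c r(1) by (intro tendstoD) (auto simp: L_def)
    with K have "\<forall>\<^sub>F n in sequentially. norm ((\<integral>x. f (c n *\<^sub>R x) \<partial>\<mu> n) - integral\<^sup>L (\<mu> n) f) < e"
    proof eventually_elim
      case (elim n)
      have fd: "\<bar>f (c n *\<^sub>R x) - f x\<bar> \<le> d + 2 * B * indicator {x. K < norm x} x" for x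
      proof (cases "K < norm x")
        case True
        then show ?thesis using B(1)[of x] B(1)[of "c n *\<^sub>R x"] \<open>d > 0\<close> by simp
      next
        case False
        then have x: "norm x < L" by (simp add: L_def)
        have "\<bar>c n\<bar> \<le> 2" using elim(2) by (auto simp: dist_real_def)
        then have "\<bar>c n\<bar> * norm x \<le> 2 * L" using x by (intro mult_mono) auto
        moreover have "dist (c n *\<^sub>R x) x < r"
        proof -
          have "dist (c n *\<^sub>R x) x = \<bar>c n - 1\<bar> * norm x"
            by (metis dist_norm norm_scaleR scaleR_left_diff_distrib scaleR_one)
          also have "\<dots> \<le> \<bar>c n - 1\<bar> * L" using x by (intro mult_left_mono) auto
          also have "\<dots> < r" using elim(2) by (simp add: dist_real_def L_def field_simps)
          finally show ?thesis .
        qed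
        ultimately have "dist (f (c n *\<^sub>R x)) (f x) < d"
          using x L_def by (intro r(2)) auto
        then show ?thesis using False by (simp add: dist_real_def)
      qed
      have "\<bar>(\<integral>x. f (c n *\<^sub>R x) \<partial>\<mu> n) - integral\<^sup>L (\<mu> n) f\<bar> \<le> d + 2 * B * measure (\<mu> n) {x. K < norm x}"
        by (rule integral_diff_le_tail[OF \<mu> fc_meas f_meas B(1) B(1) fd])
      also have "\<dots> \<le> d + 2 * B * d" using elim(1) B by (intro add_left_mono mult_left_mono) auto
      also have "\<dots> < (4 * B + 4) * d"
        using mult_pos_pos[OF B(2) \<open>d > 0\<close>] \<open>d > 0\<close> by (simp add: algebra_simps)
      also have "\<dots> = e" using B by (simp add: d_def)
      finally show ?case by simp
    qed
    then show ?case by (simp add: eventually_sequentially)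
  qed
  from tendsto_add[OF this lim]
  show "(\<lambda>n. integral\<^sup>L (distr (\<mu> n) borel (\<lambda>x. c n *\<^sub>R x)) f) \<longlonglongrightarrow> integral\<^sup>L \<nu> f"
    by (simp add: integral_distr)
qed

section \<open>A maximal inequality and a criterion for independence\<close>

text \<open>Kolmogorov's maximal inequality, proved by stopping. The martingale property enters as
  orthogonality of each increment to all bounded variables of the past, which is the form that
  independence of the tree steps delivers directly.\<close>

lemma (in prob_space) martingale_maximal_inequality:
  fixes W :: "nat \<Rightarrow> 'a \<Rightarrow> complex"
  assumes F: "\<And>n. subalgebra M (F n)" "\<And>n. sets (F n) \<subseteq> sets (F (Suc n))"
    and W: "\<And>n. W n \<in> borel_measurable (F n)" "\<And>n \<omega>. \<omega> \<in> space M \<Longrightarrow> norm (W n \<omega>) \<le> B n"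
    and orth: "\<And>n Z b. Z \<in> borel_measurable (F n) \<Longrightarrow> (\<And>\<omega>. \<omega> \<in> space M \<Longrightarrow> norm (Z \<omega>) \<le> b) \<Longrightarrow>
      (\<integral>\<omega>. Z \<omega> * (W (Suc n) \<omega> - W n \<omega>) \<partial>M) = 0"
    and C: "\<And>n. (\<Sum>k<n. \<integral>\<omega>. (norm (W (Suc k) \<omega> - W k \<omega>))\<^sup>2 \<partial>M) \<le> C"
    and "e > 0"
  shows "prob {\<omega> \<in> space M. \<exists>n. e \<le> norm (W n \<omega> - W 0 \<omega>)} \<le> C / e\<^sup>2"
proof -
  \<comment> \<open>\<open>V\<close> is the martingale \<open>W - W 0\<close> stopped when its modulus reaches \<open>e\<close>.\<close>
  define V where "V = rec_nat (\<lambda>_. 0)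
    (\<lambda>k v \<omega>. v \<omega> + (if norm (v \<omega>) < e then W (Suc k) \<omega> - W k \<omega> else 0))"
  have V_0: "V 0 = (\<lambda>_. 0)" and V_Suc: "V (Suc k) =
      (\<lambda>\<omega>. V k \<omega> + (if norm (V k \<omega>) < e then W (Suc k) \<omega> - W k \<omega> else 0))" for k
    by (simp_all add: V_def)
  have sp: "space (F n) = space M" for n using F(1) by (simp add: subalgebra_def)
  have F_mono: "f \<in> borel_measurable (F (Suc n))" if "f \<in> borel_measurable (F n)" for f :: "'a \<Rightarrow> complex" and n
    using that F(2)[of n] sp by (auto simp: measurable_def)
  have V_F: "V n \<in> borel_measurable (F n)" for n
  proof (induction n)
    case (Suc n)
    note [measurable] = F_mono[OF Suc] F_mono[OF W(1)] W(1)
    show ?case unfolding V_Suc by measurable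
  qed (simp add: V_0)
  have M_meas: "f \<in> borel_measurable M" if "f \<in> borel_measurable (F n)" for f :: "'a \<Rightarrow> complex" and n
    using measurable_from_subalg[OF F(1) that] .
  note [measurable] = M_meas[OF V_F] M_meas[OF W(1)]
  have "\<exists>b. \<forall>\<omega>\<in>space M. norm (V n \<omega>) \<le> b" for n
  proof (induction n)
    case (Suc n)
    then obtain b where b: "\<forall>\<omega>\<in>space M. norm (V n \<omega>) \<le> b" by blast
    have "norm (V (Suc n) \<omega>) \<le> b + (B (Suc n) + B n)" if "\<omega> \<in> space M" for \<omega>
    proof -
      have "norm (W (Suc n) \<omega> - W n \<omega>) \<le> B (Suc n) + B n"
        using W(2)[OF that, of "Suc n"] W(2)[OF that, of n] norm_triangle_ineq4[of "W (Suc n) \<omega>" "W n \<omega>"] by linarith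
      moreover have "0 \<le> B (Suc n) + B n" using calculation norm_ge_zero order_trans by blast
      ultimately show ?thesis
        using b that norm_triangle_ineq[of "V n \<omega>" "W (Suc n) \<omega> - W n \<omega>"] unfolding V_Suc
        by (auto intro: order_trans add_increasing2 add_mono)
    qed
    then show ?case by blast
  qed (auto simp: V_0)
  then obtain b where b: "\<And>n. \<forall>\<omega>\<in>space M. norm (V n \<omega>) \<le> b n" by metis
  have V_int: "integrable M (\<lambda>\<omega>. (norm (V n \<omega>))\<^sup>2)" for n
    using b by (intro integrable_const_bound[where B="(b n)\<^sup>2"] AE_I2) (auto intro!: power_mono)
  have W_int: "integrable M (\<lambda>\<omega>. (norm (W (Suc n) \<omega> - W n \<omega>))\<^sup>2)" for n
    using W(2) by (intro integrable_const_bound[where B="(B (Suc n) + B n)\<^sup>2"] AE_I2)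
      (auto intro!: power_mono order_trans[OF norm_triangle_ineq4] add_mono)
  have V_le: "(\<integral>\<omega>. (norm (V n \<omega>))\<^sup>2 \<partial>M) \<le> (\<Sum>k<n. \<integral>\<omega>. (norm (W (Suc k) \<omega> - W k \<omega>))\<^sup>2 \<partial>M)" for n
  proof (induction n)
    case (Suc n)
    \<comment> \<open>\<open>Z\<close> is the conjugate of \<open>V n\<close> while it is still
      running and belongs to the past, so the cross term in the square of \<open>V (Suc n)\<close>
      has mean zero. After stopping \<open>Z\<close> vanishes.\<close>
    define Z where "Z = (\<lambda>\<omega>. if norm (V n \<omega>) < e then cnj (V n \<omega>) else 0)"
    define D where "D = (\<lambda>\<omega>. W (Suc n) \<omega> - W n \<omega>)"
    have Z: "Z \<in> borel_measurable (F n)"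
    proof -
      have [measurable]: "cnj \<in> borel_measurable borel"
        by (intro borel_measurable_continuous_onI continuous_intros)
      note [measurable] = V_F[of n]
      show ?thesis unfolding Z_def by measurable
    qed
    have Z_le: "norm (Z \<omega>) \<le> e" for \<omega> using \<open>e > 0\<close> by (auto simp: Z_def)
    have Z_int: "integrable M (\<lambda>\<omega>. Z \<omega> * D \<omega>)"
    proof (rule integrable_const_bound[where B="e * (B (Suc n) + B n)"])
      show "AE \<omega> in M. norm (Z \<omega> * D \<omega>) \<le> e * (B (Suc n) + B n)"
        using W(2) \<open>e > 0\<close> unfolding norm_mult D_def
        by (intro AE_I2 mult_mono order_trans[OF norm_triangle_ineq4] add_mono Z_le) auto
      note [measurable] = M_meas[OF Z]
      show "(\<lambda>\<omega>. Z \<omega> * D \<omega>) \<in> borel_measurable M" unfolding D_def by measurable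
    qed
    have Z0: "(\<integral>\<omega>. Re (Z \<omega> * D \<omega>) \<partial>M) = 0"
      using integral_Re[OF Z_int] orth[OF Z Z_le] by (simp add: D_def)
    have D_int: "integrable M (\<lambda>\<omega>. (norm (D \<omega>))\<^sup>2)"
      using W_int by (simp add: D_def)
    note R_int = integrable_Re[OF Z_int]
    have *: "(norm (V (Suc n) \<omega>))\<^sup>2 \<le> (norm (V n \<omega>))\<^sup>2 + (norm (D \<omega>))\<^sup>2 + 2 * Re (Z \<omega> * D \<omega>)" for \<omega>
    proof (cases "norm (V n \<omega>) < e")
      case True
      then show ?thesis unfolding V_Suc cmod_power2 Z_def D_def by (simp add: power2_eq_square algebra_simps)
    qed (simp add: V_Suc Z_def)
    have "(\<integral>\<omega>. (norm (V (Suc n) \<omega>))\<^sup>2 \<partial>M) \<le>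
        (\<integral>\<omega>. (norm (V n \<omega>))\<^sup>2 + (norm (D \<omega>))\<^sup>2 + 2 * Re (Z \<omega> * D \<omega>) \<partial>M)"
      using V_int W_int R_int
      by (intro integral_mono * Bochner_Integration.integrable_add integrable_mult_right) (auto simp: D_def)
    also have "\<dots> = (\<integral>\<omega>. (norm (V n \<omega>))\<^sup>2 \<partial>M) + (\<integral>\<omega>. (norm (D \<omega>))\<^sup>2 \<partial>M) + 2 * (\<integral>\<omega>. Re (Z \<omega> * D \<omega>) \<partial>M)"
      using V_int[of n] D_int R_int by (simp del: times_complex.sel)
    also have "\<dots> = (\<integral>\<omega>. (norm (V n \<omega>))\<^sup>2 \<partial>M) + (\<integral>\<omega>. (norm (D \<omega>))\<^sup>2 \<partial>M)"
      by (simp only: Z0 mult_zero_right add_0_right)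
    finally show ?case using Suc by (simp add: D_def)
  qed (simp add: V_0)
  have V_eq: "V n \<omega> = W n \<omega> - W 0 \<omega>" if "norm (V n \<omega>) < e" for n \<omega>
    using that
  proof (induction n)
    case (Suc n)
    then show ?case unfolding V_Suc by (auto split: if_splits)
  qed (simp add: V_0)
  \<comment> \<open>Once the threshold is reached the value is frozen, so being below
    \<open>e\<close> at time \<open>n\<close> means having been below it at all earlier times. With
    \<open>V_eq\<close>, any crossing by \<open>W - W 0\<close> up to \<open>n\<close> is therefore
    visible in \<open>V n\<close>.\<close>
  have V_stop: "norm (V k \<omega>) < e" if "norm (V n \<omega>) < e" "k \<le> n" for k n \<omega>
    using that(2,1)
  proof (induction n rule: dec_induct)
    case (step n)
    then show ?case unfolding V_Suc by (auto split: if_splits)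
  qed
  let ?A = "\<lambda>n. {\<omega> \<in> space M. \<exists>k\<le>n. e \<le> norm (W k \<omega> - W 0 \<omega>)}"
  have "prob (?A n) \<le> C / e\<^sup>2" for n
  proof -
    have "prob (?A n) \<le> prob {\<omega> \<in> space M. e\<^sup>2 \<le> (norm (V n \<omega>))\<^sup>2}"
    proof (rule finite_measure_mono)
      show "?A n \<subseteq> {\<omega> \<in> space M. e\<^sup>2 \<le> (norm (V n \<omega>))\<^sup>2}"
      proof safe
        fix \<omega> k assume "k \<le> n" "e \<le> norm (W k \<omega> - W 0 \<omega>)"
        then have "e \<le> norm (V n \<omega>)" using V_stop V_eq by (metis not_less)
        then show "e\<^sup>2 \<le> (norm (V n \<omega>))\<^sup>2" using \<open>e > 0\<close> by (intro power_mono) auto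
      qed
    qed measurable
    also have "\<dots> \<le> (\<integral>\<omega>. (norm (V n \<omega>))\<^sup>2 \<partial>M) / e\<^sup>2"
      using \<open>e > 0\<close> by (intro integral_Markov_inequality_measure[where A="{}"] V_int) auto
    also have "\<dots> \<le> C / e\<^sup>2"
      using order_trans[OF V_le C] by (intro divide_right_mono) auto
    finally show ?thesis .
  qed
  moreover have "(\<lambda>n. prob (?A n)) \<longlonglongrightarrow> prob (\<Union>n. ?A n)"
    by (rule finite_Lim_measure_incseq) (auto simp: incseq_def intro: order_trans)
  moreover have "(\<Union>n. ?A n) = {\<omega> \<in> space M. \<exists>n. e \<le> norm (W n \<omega> - W 0 \<omega>)}"
    by auto
  ultimately show ?thesis by (metis (no_types, lifting) LIMSEQ_le_const2)
qed

text \<open>Preimages of Borel sets form an intersection-stable system, so the product rule passes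
  to the generated sigma-algebras. This turns product formulas for probabilities into product
  formulas for integrals.\<close>

lemma (in prob_space) indep_var_borelI:
  assumes [measurable]: "X \<in> borel_measurable M" "Y \<in> borel_measurable M"
    and *: "\<And>A B. A \<in> sets borel \<Longrightarrow> B \<in> sets borel \<Longrightarrow>
      prob {\<omega> \<in> space M. X \<omega> \<in> A \<and> Y \<omega> \<in> B} = prob {\<omega> \<in> space M. X \<omega> \<in> A} * prob {\<omega> \<in> space M. Y \<omega> \<in> B}"
  shows "indep_var borel X borel Y"
proof -
  have stable: "Int_stable {f -` A \<inter> space M |A. A \<in> sets N}" for f N
  proof (rule Int_stableI)
    fix a b assume "a \<in> {f -` A \<inter> space M |A. A \<in> sets N}" "b \<in> {f -` A \<inter> space M |A. A \<in> sets N}"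
    then obtain A B where "a = f -` A \<inter> space M" "A \<in> sets N" "b = f -` B \<inter> space M" "B \<in> sets N"
      by blast
    then show "a \<inter> b \<in> {f -` A \<inter> space M |A. A \<in> sets N}"
      by (intro CollectI exI[of _ "A \<inter> B"]) auto
  qed
  have "indep_set {X -` A \<inter> space M |A. A \<in> sets borel} {Y -` A \<inter> space M |A. A \<in> sets borel}"
  proof (rule indep_setI)
    fix a b
    assume "a \<in> {X -` A \<inter> space M |A. A \<in> sets borel}" "b \<in> {Y -` A \<inter> space M |A. A \<in> sets borel}"
    then obtain A B where "a = X -` A \<inter> space M" "A \<in> sets borel" "b = Y -` B \<inter> space M" "B \<in> sets borel"
      by blast
    then show "prob (a \<inter> b) = prob a * prob b"
      using *[of A B] by (simp add: vimage_def Int_def conj_ac)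
  qed (auto intro!: measurable_sets[OF assms(1)] measurable_sets[OF assms(2)])
  then show ?thesis
    unfolding indep_var_eq by (intro conjI indep_set_sigma_sets stable assms)
qed

section \<open>The martingale of a recursive tree walk\<close>

text \<open>Here \<open>c\<close> stands for \<open>\<phi> t\<close>. The denominator with index
  \<open>i\<close> is the total weight of the tree after node \<open>Suc i\<close> has been
  added.\<close>

definition mean_factor :: "real \<Rightarrow> complex \<Rightarrow> nat \<Rightarrow> complex" where
  "mean_factor \<rho> c n = (\<Prod>i<n. 1 - (1 - c) / (real i + 1 + \<rho>))"

lemma norm_divide_of_real: "r > 0 \<Longrightarrow> norm (z / complex_of_real r) = norm z / r"
  by (simp add: norm_divide)

text \<open>The factor equals \<open>((real i + \<rho>) + c) / (real i + 1 + \<rho>)\<close>, a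
  weighted mean of 1 and \<open>c\<close>.\<close>

lemma norm_mean_factor_step:
  fixes c :: complex
  assumes "\<rho> > 0" "norm c \<le> 1"
  shows "norm (1 - (1 - c) / (real i + 1 + \<rho>)) \<le> 1"
proof -
  have split_quotient: "1 - (1 - c) / N = ((N - 1) + c) / N" if "N \<noteq> 0" for N
    using that by (simp add: field_simps)
  have nz: "complex_of_real (real i + 1 + \<rho>) \<noteq> 0"
    using assms(1) by (simp only: of_real_eq_0_iff)
  have "1 - (1 - c) / (real i + 1 + \<rho>) = ((of_real (real i + 1 + \<rho>) - 1) + c) / of_real (real i + 1 + \<rho>)"
    by (rule split_quotient[OF nz])
  also have "of_real (real i + 1 + \<rho>) - 1 = complex_of_real (real i + \<rho>)" by simp
  also have "norm ((of_real (real i + \<rho>) + c) / of_real (real i + 1 + \<rho>)) = norm (of_real (real i + \<rho>) + c) / (real i + 1 + \<rho>)"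
    using assms(1) by (intro norm_divide_of_real) simp
  also have "norm (of_real (real i + \<rho>) + c) / (real i + 1 + \<rho>) \<le> (real i + \<rho> + 1) / (real i + 1 + \<rho>)"
  proof (rule divide_right_mono)
    show "norm (of_real (real i + \<rho>) + c) \<le> real i + \<rho> + 1"
    using assms norm_triangle_ineq[of "of_real (real i + \<rho>)" c] unfolding norm_of_real by simp
  qed (use assms(1) in simp)
  also have "\<dots> = 1" using assms(1) by simp
  finally show ?thesis .
qed

lemma norm_mean_factor_le: "\<rho> > 0 \<Longrightarrow> norm c \<le> 1 \<Longrightarrow> norm (mean_factor \<rho> c n) \<le> 1"
  unfolding mean_factor_def prod_norm[symmetric]
  by (intro prod_le_1 conjI norm_ge_zero norm_mean_factor_step)

text \<open>For factors in the closed unit disc the distance between two products is at most the sum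
  of the distances between the factors. The logarithmic growth of the bound is harmless, since
  \<open>variance_term\<close> remains summable.\<close>

lemma norm_one_minus_mean_factor_le:
  assumes "\<rho> > 0" "norm c \<le> 1"
  shows "norm (1 - mean_factor \<rho> c n) \<le> norm (1 - c) * harm n"
proof -
  have "norm (1 - mean_factor \<rho> c n) = norm ((\<Prod>i<n. 1) - (\<Prod>i<n. 1 - (1 - c) / (real i + 1 + \<rho>)))"
    by (simp add: mean_factor_def)
  also have "\<dots> \<le> (\<Sum>i<n. norm (1 - (1 - (1 - c) / (real i + 1 + \<rho>))))"
    using norm_mean_factor_step[OF assms] by (intro norm_prod_diff) auto
  also have "\<dots> \<le> (\<Sum>i<n. norm (1 - c) * inverse (real (Suc i)))"
  proof (rule sum_mono)
    fix i
    have "norm (1 - (1 - (1 - c) / (real i + 1 + \<rho>))) = norm (1 - c) / (real i + 1 + \<rho>)"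
      using norm_divide_of_real[of "real i + 1 + \<rho>" "1 - c"] assms(1)
      by (simp only: diff_diff_eq2 add_diff_cancel_left')
    also have "\<dots> \<le> norm (1 - c) / real (Suc i)"
      using assms by (intro divide_left_mono) auto
    finally show "norm (1 - (1 - (1 - c) / (real i + 1 + \<rho>))) \<le> norm (1 - c) * inverse (real (Suc i))"
      by (simp add: field_simps)
  qed
  also have "\<dots> = norm (1 - c) * harm n"
    unfolding harm_def sum_distrib_left by (rule sum.atLeast1_atMost_eq[symmetric, unfolded One_nat_def[symmetric]])
  finally show ?thesis .
qed

text \<open>The factor with index \<open>i\<close> has squared modulus at least \<open>((i + 1) / (i + 2))\<^sup>1\<^sup>/\<^sup>2\<close>, and these bounds telescope.\<close>

lemma norm_mean_factor_ge:
  assumes "\<rho> > 0" "norm (1 - c) \<le> 1 / 8"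
  shows "1 / sqrt (real n + 1) \<le> (norm (mean_factor \<rho> c n))\<^sup>2"
proof (induction n)
  case (Suc n)
  define x where "x = 1 / (real n + 1)"
  have x: "0 < x" "x \<le> 1" by (auto simp: x_def)
  have "norm ((1 - c) / (real n + 1 + \<rho>)) = norm (1 - c) / (real n + 1 + \<rho>)"
    using assms(1) by (intro norm_divide_of_real) simp
  also have "\<dots> \<le> (1 / 8) / (real n + 1)"
    using assms by (intro frac_le) auto
  also have "\<dots> = x / 8" by (simp add: x_def)
  finally have "1 - x / 8 \<le> norm (1 - (1 - c) / (real n + 1 + \<rho>))"
    using norm_triangle_ineq2[of 1 "(1 - c) / (real n + 1 + \<rho>)"] by simp
  then have "(1 - x / 8)\<^sup>2 \<le> (norm (1 - (1 - c) / (real n + 1 + \<rho>)))\<^sup>2"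
    using x by (intro power_mono) auto
  moreover have "1 - x / 4 \<le> (1 - x / 8)\<^sup>2" using x by (simp add: power2_eq_square algebra_simps)
  ultimately have *: "1 - x / 4 \<le> (norm (1 - (1 - c) / (real n + 1 + \<rho>)))\<^sup>2" by linarith
  \<comment> \<open>The radicand is \<open>1 / (1 + x)\<close>, so this amounts to
    \<open>(1 - x / 4)\<^sup>2 * (1 + x) \<ge> 1\<close>; the excess over 1 is \<open>x\<close>
    times a polynomial that is positive for \<open>0 < x \<le> 1\<close>.\<close>
  have "sqrt ((real n + 1) / (real n + 2)) \<le> 1 - x / 4"
  proof (rule real_le_lsqrt)
    have "(real n + 1) / (real n + 2) = 1 / (1 + x)" by (simp add: x_def field_simps)
    also have "\<dots> \<le> (1 - x / 4)\<^sup>2"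
    proof -
      have "(1 - x / 4)\<^sup>2 * (1 + x) - 1 = x * (1 / 2 - 7 / 16 * x + x\<^sup>2 / 16)"
        by (simp add: power2_eq_square field_simps)
      moreover have "0 \<le> 1 / 2 - 7 / 16 * x + x\<^sup>2 / 16"
        using x zero_le_power2[of x] by linarith
      then have "0 \<le> x * (1 / 2 - 7 / 16 * x + x\<^sup>2 / 16)" using x by simp
      ultimately have "1 \<le> (1 - x / 4)\<^sup>2 * (1 + x)" by linarith
      then show ?thesis using x by (simp add: pos_divide_le_eq)
    qed
    finally show "(real n + 1) / (real n + 2) \<le> (1 - x / 4)\<^sup>2" .
  qed (use x in auto)
  then have "1 / sqrt (real n + 1) * sqrt ((real n + 1) / (real n + 2)) \<le>
      (norm (mean_factor \<rho> c n))\<^sup>2 * (norm (1 - (1 - c) / (real n + 1 + \<rho>)))\<^sup>2"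
    using Suc * by (intro mult_mono) auto
  also have "\<dots> = (norm (mean_factor \<rho> c (Suc n)))\<^sup>2"
    by (simp add: mean_factor_def norm_mult power_mult_distrib)
  also have "1 / sqrt (real n + 1) * sqrt ((real n + 1) / (real n + 2)) = 1 / sqrt (real (Suc n) + 1)"
    by (simp add: real_sqrt_divide add_ac)
  finally show ?case .
qed (simp add: mean_factor_def)

text \<open>Times \<open>norm (1 - \<phi> t)\<close>, this bounds the mean square of the
  \<open>k\<close>-th martingale increment: \<open>2 * (1 + harm k)\<close> comes from the
  innovation, \<open>(real k + 1)\<^sup>2\<close> from the total weight, and
  \<open>sqrt (real k + 2)\<close> from \<open>norm_mean_factor_ge\<close> at
  \<open>Suc k\<close>.\<close>

definition variance_term :: "nat \<Rightarrow> real" where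
  "variance_term k = 2 * (1 + harm k) * sqrt (real k + 2) / (real k + 1)\<^sup>2"

lemma variance_term_nonneg: "0 \<le> variance_term k"
  by (simp add: variance_term_def harm_nonneg)

text \<open>Harmonic numbers differ from the logarithm by a bounded amount, so
  \<open>1 + harm k\<close> grows at most like \<open>k powr (1 / 4)\<close>; the other factor has
  order \<open>k powr (- 3 / 2)\<close>, and the exponents add up to less than -1.\<close>

lemma summable_variance_term: "summable variance_term"
proof (rule summable_comparison_test_bigo)
  show "summable (\<lambda>k. norm (real k powr (- 5 / 4)))"
    by (simp add: summable_real_powr_iff)
  have 1: "(\<lambda>_. 1) \<in> O(\<lambda>n. real n powr (1 / 4))" by real_asymp
  have "(\<lambda>n. harm n - ln (real n)) \<in> O(\<lambda>_. 1 :: real)"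
    using euler_mascheroni_LIMSEQ by (intro bigoI_tendsto[where c=euler_mascheroni]) auto
  then have 2: "(\<lambda>n. harm n - ln (real n)) \<in> O(\<lambda>n. real n powr (1 / 4))"
    using 1 by (rule landau_o.big_trans)
  have "(\<lambda>n. ln (real n)) \<in> O(\<lambda>n. real n powr (1 / 4))" by real_asymp
  from sum_in_bigo(1)[OF 1 sum_in_bigo(1)[OF 2 this]]
  have "(\<lambda>n. 1 + ((harm n - ln (real n)) + ln (real n))) \<in> O(\<lambda>n. real n powr (1 / 4))" .
  moreover have "(\<lambda>k. 2 * sqrt (real k + 2) / (real k + 1)\<^sup>2) \<in> O(\<lambda>k. real k powr (- 3 / 2))"
    by real_asymp
  ultimately have "(\<lambda>k. (1 + ((harm k - ln (real k)) + ln (real k))) * (2 * sqrt (real k + 2) / (real k + 1)\<^sup>2)) \<in>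
      O(\<lambda>k. real k powr (1 / 4) * real k powr (- 3 / 2))"
    by (rule landau_o.big.mult)
  moreover have "variance_term = (\<lambda>k. (1 + ((harm k - ln (real k)) + ln (real k))) * (2 * sqrt (real k + 2) / (real k + 1)\<^sup>2))"
    by (simp add: variance_term_def fun_eq_iff)
  moreover have "real k powr (1 / 4) * real k powr (- 3 / 2) = real k powr (- 5 / 4)" for k
    by (simp flip: powr_add)
  ultimately show "variance_term \<in> O(\<lambda>k. real k powr (- 5 / 4))"
    by (simp only:)
qed

section \<open>Independence of the next tree step from the past\<close>

locale recursive_tree_walk = prob_space M for M :: "'a measure" +
  fixes \<rho> :: real and par :: "nat \<Rightarrow> 'a \<Rightarrow> nat" and \<L> :: "(real ^ 'd) measure"
    and \<eta> X :: "nat \<Rightarrow> 'a \<Rightarrow> real ^ 'd"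
  assumes \<rho>: "\<rho> > 0"
    and tree: "weighted_random_recursive_tree \<rho> M par"
    and walk: "branching_random_walk M par \<L> \<eta> X"
begin

lemma par_meas [measurable]: "par n \<in> measurable M (count_space UNIV)"
  using tree by (simp add: weighted_random_recursive_tree_def)

lemma par_le: "\<omega> \<in> space M \<Longrightarrow> par n \<omega> \<le> n"
  using tree by (simp add: weighted_random_recursive_tree_def)

lemma prob_par: "v \<le> n \<Longrightarrow> prob {\<omega> \<in> space M. (\<forall>k<n. par k \<omega> = h k) \<and> par n \<omega> = v} =
    node_weight \<rho> v / total_weight \<rho> n * prob {\<omega> \<in> space M. \<forall>k<n. par k \<omega> = h k}"
  using tree by (simp add: weighted_random_recursive_tree_def)

lemma \<eta>_indep: "indep_vars (\<lambda>_. borel) \<eta> UNIV"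
  using walk by (simp add: branching_random_walk_def)

lemma \<eta>_meas [measurable]: "\<eta> n \<in> borel_measurable M"
  using \<eta>_indep by (simp add: indep_vars_def)

lemma \<eta>_law: "distr M borel (\<eta> n) = \<L>"
  using walk by (simp add: branching_random_walk_def)

lemma X_0: "\<omega> \<in> space M \<Longrightarrow> X 0 \<omega> = 0"
  and X_Suc: "\<omega> \<in> space M \<Longrightarrow> X (Suc n) \<omega> = X (par n \<omega>) \<omega> + \<eta> (Suc n) \<omega>"
  using walk by (simp_all add: branching_random_walk_def)

lemma prob_tree_walk:
  assumes "A \<in> sets (Pi\<^sub>M UNIV (\<lambda>_. borel))" "B \<in> sets (Pi\<^sub>M UNIV (\<lambda>_. count_space UNIV))"
  shows "prob {\<omega> \<in> space M. (\<lambda>v. \<eta> v \<omega>) \<in> A \<and> (\<lambda>n. par n \<omega>) \<in> B} =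
    prob {\<omega> \<in> space M. (\<lambda>v. \<eta> v \<omega>) \<in> A} * prob {\<omega> \<in> space M. (\<lambda>n. par n \<omega>) \<in> B}"
proof -
  have "indep_set (sets (vimage_algebra (space M) (\<lambda>\<omega> v. \<eta> v \<omega>) (Pi\<^sub>M UNIV (\<lambda>_. borel))))
       (sets (vimage_algebra (space M) (\<lambda>\<omega> n. par n \<omega>) (Pi\<^sub>M UNIV (\<lambda>_. count_space UNIV))))"
    using walk by (simp add: branching_random_walk_def indep_of_tree_def)
  from indep_setD[OF this in_vimage_algebra[OF assms(1)] in_vimage_algebra[OF assms(2)]]
  show ?thesis by (simp add: vimage_def Int_def conj_ac)
qed

abbreviation "p n v \<equiv> node_weight \<rho> v / total_weight \<rho> n"

lemma sum_p: "(\<Sum>v\<le>n. p n v) = 1"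
  using \<rho> total_weight_eq[of \<rho> n] by (simp add: total_weight_def flip: sum_divide_distrib)

lemma p_nonneg: "0 \<le> p n v"
  using \<rho> total_weight_eq[of \<rho> n] by (simp add: node_weight_def)

text \<open>\<open>past n\<close> determines \<open>T\<^sub>n\<close> and the positions of its nodes.\<close>

definition past :: "nat \<Rightarrow> 'a \<Rightarrow> (nat \<Rightarrow> nat) \<times> (nat \<Rightarrow> real ^ 'd)" where
  "past n \<omega> = (\<lambda>k\<in>{..<n}. par k \<omega>, \<lambda>k\<in>{..n}. \<eta> k \<omega>)"

abbreviation past_space :: "nat \<Rightarrow> ((nat \<Rightarrow> nat) \<times> (nat \<Rightarrow> real ^ 'd)) measure" where
  "past_space n \<equiv> Pi\<^sub>M {..<n} (\<lambda>_. count_space UNIV) \<Otimes>\<^sub>M Pi\<^sub>M {..n} (\<lambda>_. borel)"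

definition F :: "nat \<Rightarrow> 'a measure" where
  "F n = vimage_algebra (space M) (past n) (past_space n)"

lemma past_meas: "past n \<in> measurable M (past_space n)"
  unfolding past_def by measurable

text \<open>The event is split by the parent history \<open>h\<close> and the next parent
  \<open>v\<close>. Each piece is the intersection of a tree event and an independent offset event;
  the latter splits again because \<open>\<eta> (Suc n)\<close> is independent of the offsets up to
  \<open>n\<close>. Given the history, the next parent's law does not depend on \<open>h\<close>, so
  the double sum factorises.\<close>

lemma prob_past_step:
  assumes D: "D \<in> sets (past_space n)" and E: "E \<in> sets (count_space UNIV \<Otimes>\<^sub>M borel)"
  shows "prob {\<omega> \<in> space M. past n \<omega> \<in> D \<and> (par n \<omega>, \<eta> (Suc n) \<omega>) \<in> E} =
    (\<Sum>h\<in>PiE {..<n} (\<lambda>k. {..k}). prob {\<omega> \<in> space M. \<forall>k<n. par k \<omega> = h k} *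
        prob {\<omega> \<in> space M. (h, \<lambda>k\<in>{..n}. \<eta> k \<omega>) \<in> D}) *
    (\<Sum>v\<le>n. p n v * prob {\<omega> \<in> space M. (v, \<eta> (Suc n) \<omega>) \<in> E})"
proof -
  \<comment> \<open>As \<open>par k \<le> k\<close>, the possible histories form a finite set;
    extensionality makes each of them a unique index.\<close>
  let ?H = "PiE {..<n} (\<lambda>k. {..k})"
  let ?\<eta> = "\<lambda>\<omega>. \<lambda>k\<in>{..n}. \<eta> k \<omega>"
  let ?T = "\<lambda>h v. {\<omega> \<in> space M. (\<forall>k<n. par k \<omega> = h k) \<and> par n \<omega> = v}"
  let ?R = "\<lambda>h v. {\<omega> \<in> space M. (h, ?\<eta> \<omega>) \<in> D \<and> (v, \<eta> (Suc n) \<omega>) \<in> E}"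
  have D1: "Pair h -` D \<in> sets (Pi\<^sub>M {..n} (\<lambda>_. borel))" for h
    by (rule sets_Pair1[OF D])
  have E1: "Pair v -` E \<in> sets borel" for v
    by (rule sets_Pair1[OF E])
  have D2: "{f. (h, restrict f {..n}) \<in> D} \<in> sets (Pi\<^sub>M UNIV (\<lambda>_. borel))" for h
  proof -
    have "(\<lambda>f. restrict f {..n}) \<in> measurable (Pi\<^sub>M UNIV (\<lambda>_. borel :: (real ^ 'd) measure)) (Pi\<^sub>M {..n} (\<lambda>_. borel))"
      by (rule measurable_restrict_subset) simp
    from measurable_sets[OF this D1[of h]] show ?thesis
      by (simp add: space_PiM vimage_def)
  qed
  have E2: "{f. (v, f (Suc n)) \<in> E} \<in> sets (Pi\<^sub>M UNIV (\<lambda>_. borel))" for v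
  proof -
    have "(\<lambda>f. f (Suc n)) \<in> measurable (Pi\<^sub>M UNIV (\<lambda>_. borel :: (real ^ 'd) measure)) borel"
      by (rule measurable_component_singleton) simp
    from measurable_sets[OF this E1[of v]] show ?thesis
      by (simp add: space_PiM vimage_def)
  qed
  have T2: "{f. (\<forall>k<n. f k = h k) \<and> f n = v} \<in> sets (Pi\<^sub>M UNIV (\<lambda>_. count_space UNIV))" for h and v :: nat
  proof -
    have "{f \<in> space (Pi\<^sub>M UNIV (\<lambda>_. count_space UNIV)). (\<forall>k<n. f k = h k) \<and> f n = v} \<in> sets (Pi\<^sub>M UNIV (\<lambda>_. count_space UNIV))"
      by measurable
    then show ?thesis by (simp add: space_PiM)
  qed
  have prob_R: "prob (?R h v) = prob {\<omega> \<in> space M. (h, ?\<eta> \<omega>) \<in> D} * prob {\<omega> \<in> space M. (v, \<eta> (Suc n) \<omega>) \<in> E}" for h v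
  proof -
    let ?E = "{f \<in> space (Pi\<^sub>M {Suc n} (\<lambda>_. borel)). (v, f (Suc n)) \<in> E}"
    have iv: "indep_var (Pi\<^sub>M {..n} (\<lambda>_. borel)) ?\<eta> (Pi\<^sub>M {Suc n} (\<lambda>_. borel)) (\<lambda>\<omega>. \<lambda>k\<in>{Suc n}. \<eta> k \<omega>)"
      using indep_var_restrict[OF \<eta>_indep, of "{..n}" "{Suc n}"] by simp
    have E3: "?E \<in> sets (Pi\<^sub>M {Suc n} (\<lambda>_. borel))"
      using E by measurable
    have sp: "(\<lambda>k\<in>{Suc n}. \<eta> k \<omega>) \<in> space (Pi\<^sub>M {Suc n} (\<lambda>_. borel))" for \<omega>
      by (simp add: space_PiM)
    from indep_varD[OF iv D1[of h] E3] show ?thesis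
      by (simp add: vimage_def Int_def conj_ac sp)
  qed
  have prob_TR: "prob (?R h v \<inter> ?T h v) = prob (?R h v) * prob (?T h v)" for h v
    using prob_tree_walk[OF sets.Int[OF D2[of h] E2[of v]] T2[of h v]]
    by (simp add: Int_def conj_ac)
  have R_ev: "?R h v \<in> events" for h v
  proof -
    have "?\<eta> \<in> measurable M (Pi\<^sub>M {..n} (\<lambda>_. borel))" by measurable
    from sets.Int[OF measurable_sets[OF this D1[of h]] measurable_sets[OF \<eta>_meas[of "Suc n"] E1[of v]]]
    moreover have "(?\<eta> -` (Pair h -` D) \<inter> space M) \<inter> (\<eta> (Suc n) -` (Pair v -` E) \<inter> space M) = ?R h v"
      by auto
    ultimately show ?thesis by simp
  qed
  have T_ev: "?T h v \<in> events" for h v by measurable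
  have LU: "{\<omega> \<in> space M. past n \<omega> \<in> D \<and> (par n \<omega>, \<eta> (Suc n) \<omega>) \<in> E} =
      (\<Union>(h, v)\<in>?H \<times> {..n}. ?R h v \<inter> ?T h v)" (is "?L = ?U")
  proof (intro equalityI subsetI)
    fix \<omega> assume w: "\<omega> \<in> ?L"
    let ?h = "\<lambda>k\<in>{..<n}. par k \<omega>"
    have "?h \<in> ?H" using w par_le by auto
    moreover have "\<omega> \<in> ?R ?h (par n \<omega>) \<inter> ?T ?h (par n \<omega>)" using w by (simp add: past_def)
    moreover have "par n \<omega> \<le> n" using par_le w by blast
    ultimately show "\<omega> \<in> ?U" by (intro UN_I[of "(?h, par n \<omega>)"]) simp_all
  next
    fix \<omega> assume "\<omega> \<in> ?U"
    then obtain h v where h: "h \<in> ?H" "\<omega> \<in> ?R h v" "\<omega> \<in> ?T h v" by auto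
    have "(\<lambda>k\<in>{..<n}. par k \<omega>) = h"
      using h by (intro extensionalityI[of _ "{..<n}"]) (auto simp: PiE_def)
    with h show "\<omega> \<in> ?L" by (simp add: past_def)
  qed
  have "prob ?L = prob ?U" by (rule arg_cong[OF LU])
  also have "prob ?U = (\<Sum>(h, v)\<in>?H \<times> {..n}. prob (?R h v \<inter> ?T h v))"
  proof (subst finite_measure_finite_Union)
    show "finite (?H \<times> {..n})" by (intro finite_cartesian_product finite_PiE) auto
    show "disjoint_family_on (\<lambda>(h, v). ?R h v \<inter> ?T h v) (?H \<times> {..n})"
    proof -
      have "h = h' \<and> v = v'" if "h \<in> ?H" "h' \<in> ?H" "\<omega> \<in> ?T h v" "\<omega> \<in> ?T h' v'" for h h' v v' \<omega>
      proof -
        have "h k = h' k" if "k \<in> {..<n}" for k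
          using that \<open>\<omega> \<in> ?T h v\<close> \<open>\<omega> \<in> ?T h' v'\<close> by simp
        then have "h = h'" using PiE_ext[OF that(1,2)] by blast
        then show ?thesis using that by auto
      qed
      note eq = this
      show ?thesis
        unfolding disjoint_family_on_def
      proof (intro ballI impI equals0I, elim SigmaE, hypsubst, unfold prod.case)
        fix \<omega> h v h' v'
        assume "(h, v) \<noteq> (h', v')" "h \<in> ?H" "h' \<in> ?H"
          and "\<omega> \<in> ?R h v \<inter> ?T h v \<inter> (?R h' v' \<inter> ?T h' v')"
        then have "h = h' \<and> v = v'" by (intro eq[of h h' \<omega> v v']) blast+
        then show False using \<open>(h, v) \<noteq> (h', v')\<close> by simp
      qed
    qed
    show "(\<lambda>(h, v). ?R h v \<inter> ?T h v) ` (?H \<times> {..n}) \<subseteq> events"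
    proof (rule image_subsetI, erule SigmaE, hypsubst, unfold prod.case)
      show "?R h v \<inter> ?T h v \<in> events" for h v
        by (rule sets.Int[OF R_ev T_ev])
    qed
  qed (rule sum.cong[OF refl], erule SigmaE, simp only: prod.case)
  also have "\<dots> = (\<Sum>(h, v)\<in>?H \<times> {..n}. (prob {\<omega> \<in> space M. \<forall>k<n. par k \<omega> = h k} *
        prob {\<omega> \<in> space M. (h, ?\<eta> \<omega>) \<in> D}) * (p n v * prob {\<omega> \<in> space M. (v, \<eta> (Suc n) \<omega>) \<in> E}))"
  proof (rule sum.cong[OF refl], goal_cases)
    case (1 x)
    then obtain h v where x: "x = (h, v)" and "v \<le> n" by blast
    have "prob (?R h v \<inter> ?T h v) = prob (?R h v) * prob (?T h v)" by (rule prob_TR)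
    also have "\<dots> = prob {\<omega> \<in> space M. (h, ?\<eta> \<omega>) \<in> D} * prob {\<omega> \<in> space M. (v, \<eta> (Suc n) \<omega>) \<in> E} *
      (p n v * prob {\<omega> \<in> space M. \<forall>k<n. par k \<omega> = h k})"
      by (rule arg_cong2[of _ _ _ _ "(*)", OF prob_R prob_par[OF \<open>v \<le> n\<close>]])
    finally have "prob (?R h v \<inter> ?T h v) = (prob {\<omega> \<in> space M. \<forall>k<n. par k \<omega> = h k} *
        prob {\<omega> \<in> space M. (h, ?\<eta> \<omega>) \<in> D}) * (p n v * prob {\<omega> \<in> space M. (v, \<eta> (Suc n) \<omega>) \<in> E})"
      by (simp only: mult_ac)
    then show ?case unfolding x prod.case .
  qed
  also have "\<dots> = (\<Sum>h\<in>?H. prob {\<omega> \<in> space M. \<forall>k<n. par k \<omega> = h k} * prob {\<omega> \<in> space M. (h, ?\<eta> \<omega>) \<in> D}) *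
      (\<Sum>v\<le>n. p n v * prob {\<omega> \<in> space M. (v, \<eta> (Suc n) \<omega>) \<in> E})"
    by (subst sum_product, subst sum.cartesian_product, rule refl)
  finally show ?thesis .
qed

lemma past_space_eq: "past n \<omega> \<in> space (past_space n)"
  by (simp add: past_def space_pair_measure space_PiM)

lemma prob_past:
  assumes D: "D \<in> sets (past_space n)"
  shows "prob {\<omega> \<in> space M. past n \<omega> \<in> D} =
    (\<Sum>h\<in>PiE {..<n} (\<lambda>k. {..k}). prob {\<omega> \<in> space M. \<forall>k<n. par k \<omega> = h k} *
        prob {\<omega> \<in> space M. (h, \<lambda>k\<in>{..n}. \<eta> k \<omega>) \<in> D})"
proof -
  \<comment> \<open>With \<open>E\<close> the whole space the second factor is 1 by
    \<open>sum_p\<close>, so the first factor is the probability sought.\<close>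
  have "UNIV \<in> sets (count_space (UNIV :: nat set) \<Otimes>\<^sub>M (borel :: (real ^ 'd) measure))"
    using sets.top[of "count_space (UNIV :: nat set) \<Otimes>\<^sub>M (borel :: (real ^ 'd) measure)"]
    by (simp add: space_pair_measure)
  from prob_past_step[OF D this] show ?thesis using sum_p[of n] prob_space by simp
qed

text \<open>Combined with \<open>prob_next\<close>, this is the independence of the pair of
  \<open>par n\<close> and \<open>\<eta> (Suc n)\<close> from \<open>past n\<close>.\<close>

lemma prob_past_step_eq:
  assumes D: "D \<in> sets (past_space n)" and E: "E \<in> sets (count_space UNIV \<Otimes>\<^sub>M borel)"
  shows "prob {\<omega> \<in> space M. past n \<omega> \<in> D \<and> (par n \<omega>, \<eta> (Suc n) \<omega>) \<in> E} =
    prob {\<omega> \<in> space M. past n \<omega> \<in> D} * (\<Sum>v\<le>n. p n v * prob {\<omega> \<in> space M. (v, \<eta> (Suc n) \<omega>) \<in> E})"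
  unfolding prob_past[OF D] by (rule prob_past_step[OF D E])

lemma prob_next:
  assumes E: "E \<in> sets (count_space UNIV \<Otimes>\<^sub>M borel)"
  shows "prob {\<omega> \<in> space M. (par n \<omega>, \<eta> (Suc n) \<omega>) \<in> E} =
    (\<Sum>v\<le>n. p n v * prob {\<omega> \<in> space M. (v, \<eta> (Suc n) \<omega>) \<in> E})"
  using prob_past_step_eq[OF sets.top E] past_space_eq prob_space by simp

lemma prob_par_eq: "v \<le> n \<Longrightarrow> prob {\<omega> \<in> space M. par n \<omega> = v} = p n v"
proof -
  assume "v \<le> n"
  have E: "{v} \<times> UNIV \<in> sets (count_space (UNIV :: nat set) \<Otimes>\<^sub>M (borel :: (real ^ 'd) measure))"
    by simp
  have "p n u * prob {\<omega> \<in> space M. (u, \<eta> (Suc n) \<omega>) \<in> {v} \<times> UNIV} = (if u = v then p n v else 0)" for u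
    using prob_space by (cases "u = v") simp_all
  then have "(\<Sum>u\<le>n. p n u * prob {\<omega> \<in> space M. (u, \<eta> (Suc n) \<omega>) \<in> {v} \<times> UNIV}) = p n v"
    using \<open>v \<le> n\<close> by (simp only: sum.delta finite_atMost atMost_iff if_True)
  with prob_next[OF E, of n] show ?thesis by simp
qed

lemma sets_F: "sets (F n) = {past n -` D \<inter> space M | D. D \<in> sets (past_space n)}"
  unfolding F_def using past_space_eq by (intro sets_vimage_algebra2) blast

lemma space_F: "space (F n) = space M"
  by (simp add: F_def)

lemma past_meas_F: "past n \<in> measurable (F n) (past_space n)"
  unfolding F_def using past_space_eq by (intro measurable_vimage_algebra1) blast

lemma subalgebra_F: "subalgebra M (F n)"
  unfolding subalgebra_def sets_F using measurable_sets[OF past_meas] by (auto simp: space_F)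

lemma par_meas_F: "k < n \<Longrightarrow> par k \<in> measurable (F n) (count_space UNIV)"
proof -
  assume "k < n"
  then have "(\<lambda>x. fst x k) \<in> measurable (past_space n) (count_space UNIV)"
    by (intro measurable_compose[OF measurable_fst measurable_component_singleton]) simp
  from measurable_compose[OF past_meas_F this] show ?thesis
    using \<open>k < n\<close> by (simp add: past_def)
qed

lemma \<eta>_meas_F: "k \<le> n \<Longrightarrow> \<eta> k \<in> measurable (F n) borel"
proof -
  assume "k \<le> n"
  then have "(\<lambda>x. snd x k) \<in> measurable (past_space n) borel"
    by (intro measurable_compose[OF measurable_snd measurable_component_singleton]) simp
  from measurable_compose[OF past_meas_F this] show ?thesis
    using \<open>k \<le> n\<close> by (simp add: past_def)
qed

lemma sets_F_mono: "sets (F n) \<subseteq> sets (F (Suc n))"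
proof -
  have "past n \<in> measurable (F (Suc n)) (past_space n)"
    unfolding past_def
    by (intro measurable_Pair measurable_restrict par_meas_F \<eta>_meas_F) auto
  from measurable_sets[OF this] show ?thesis by (auto simp: sets_F[of n] space_F)
qed

text \<open>The induction runs over all earlier nodes, since any of them may be the parent of
  \<open>Suc m\<close>; the position at the random index \<open>par m\<close> is written as a finite
  sum over its possible values.\<close>

lemma X_meas_F: "v \<le> n \<Longrightarrow> X v \<in> borel_measurable (F n)"
proof (induction v rule: less_induct)
  case (less v)
  show ?case
  proof (cases v)
    case 0
    have "X 0 \<in> borel_measurable (F n) \<longleftrightarrow> (\<lambda>_. 0 :: real ^ 'd) \<in> borel_measurable (F n)"
      by (rule measurable_cong) (simp add: space_F X_0)
    then show ?thesis using 0 by simp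
  next
    case (Suc m)
    have [measurable]: "par m \<in> measurable (F n) (count_space UNIV)"
      "\<eta> (Suc m) \<in> measurable (F n) borel"
      using less.prems Suc by (auto intro: par_meas_F \<eta>_meas_F)
    have "X (Suc m) \<in> borel_measurable (F n) \<longleftrightarrow>
        (\<lambda>\<omega>. (\<Sum>u\<le>m. if par m \<omega> = u then X u \<omega> else 0) + \<eta> (Suc m) \<omega>) \<in> borel_measurable (F n)"
      by (rule measurable_cong) (simp add: space_F X_Suc par_le)
    also have "\<dots>"
    proof (intro borel_measurable_add borel_measurable_sum)
      fix u assume "u \<in> {..m}"
      then have [measurable]: "X u \<in> borel_measurable (F n)"
        using less Suc by auto
      show "(\<lambda>\<omega>. if par m \<omega> = u then X u \<omega> else 0) \<in> borel_measurable (F n)"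
        by measurable
    qed measurable
    finally show ?thesis using Suc by simp
  qed
qed

lemma X_meas [measurable]: "X v \<in> borel_measurable M"
  using measurable_from_subalg[OF subalgebra_F X_meas_F[OF order_refl]] .

lemma integral_par_\<eta>:
  fixes g :: "real ^ 'd \<Rightarrow> complex"
  assumes g [measurable]: "g \<in> borel_measurable borel" and g1: "\<And>x. norm (g x) \<le> 1" and v: "v \<le> n"
  shows "(\<integral>\<omega>. indicator {v} (par n \<omega>) * g (\<eta> (Suc n) \<omega>) \<partial>M) = p n v * (\<integral>x. g x \<partial>\<L>)"
proof -
  have m1: "(\<lambda>\<omega>. indicator {v} (par n \<omega>) :: complex) \<in> borel_measurable M"
    by (rule measurable_compose[OF par_meas]) simp
  have m2: "(\<lambda>\<omega>. g (\<eta> (Suc n) \<omega>)) \<in> borel_measurable M"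
    by (rule measurable_compose[OF \<eta>_meas g])
  have iv: "indep_var borel (\<lambda>\<omega>. indicator {v} (par n \<omega>) :: complex) borel (\<lambda>\<omega>. g (\<eta> (Suc n) \<omega>))"
  proof (rule indep_var_borelI[OF m1 m2])
    fix A B :: "complex set" assume AB: "A \<in> sets borel" "B \<in> sets borel"
    have "(\<lambda>f. f (Suc n)) \<in> measurable (Pi\<^sub>M UNIV (\<lambda>_. borel :: (real ^ 'd) measure)) borel"
      by (rule measurable_component_singleton) simp
    from measurable_sets[OF measurable_compose[OF this g] AB(2)]
    have B: "{f. g (f (Suc n)) \<in> B} \<in> sets (Pi\<^sub>M UNIV (\<lambda>_. borel))"
      by (simp add: space_PiM vimage_def)
    have "(\<lambda>f. f n) \<in> measurable (Pi\<^sub>M UNIV (\<lambda>_. count_space UNIV :: nat measure)) (count_space UNIV)"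
      by (rule measurable_component_singleton) simp
    from measurable_sets[OF this, of "{k. (indicator {v} k :: complex) \<in> A}"] have A: "{f. (indicator {v} (f n) :: complex) \<in> A} \<in> sets (Pi\<^sub>M UNIV (\<lambda>_. count_space UNIV))"
      by (simp add: space_PiM vimage_def)
    show "prob {\<omega> \<in> space M. (indicator {v} (par n \<omega>) :: complex) \<in> A \<and> g (\<eta> (Suc n) \<omega>) \<in> B} =
       prob {\<omega> \<in> space M. (indicator {v} (par n \<omega>) :: complex) \<in> A} * prob {\<omega> \<in> space M. g (\<eta> (Suc n) \<omega>) \<in> B}"
      using prob_tree_walk[OF B A] by (simp add: conj_commute mult.commute)
  qed
  have i1: "integrable M (\<lambda>\<omega>. indicator {v} (par n \<omega>) :: complex)"
    by (rule integrable_const_bound[where B=1]) (use m1 in \<open>auto simp: indicator_def\<close>)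
  have i2: "integrable M (\<lambda>\<omega>. g (\<eta> (Suc n) \<omega>))"
    by (rule integrable_const_bound[where B=1]) (use m2 in \<open>auto simp: g1\<close>)
  have "(\<integral>\<omega>. indicator {v} (par n \<omega>) \<partial>M) = complex_of_real (\<integral>\<omega>. indicator {\<omega> \<in> space M. par n \<omega> = v} \<omega> \<partial>M)"
    unfolding integral_complex_of_real[symmetric]
    by (intro Bochner_Integration.integral_cong) (auto simp: indicator_def)
  also have "\<dots> = p n v"
    using prob_par_eq[OF v] by (simp add: Int_absorb1 subset_eq)
  finally have "(\<integral>\<omega>. indicator {v} (par n \<omega>) \<partial>M) = complex_of_real (p n v)" .
  moreover have "(\<integral>\<omega>. g (\<eta> (Suc n) \<omega>) \<partial>M) = (\<integral>x. g x \<partial>\<L>)"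
    unfolding \<eta>_law[of "Suc n", symmetric] by (simp add: integral_distr)
  ultimately show ?thesis
    using indep_var_lebesgue_integral[OF iv i1 i2] by simp
qed

text \<open>Plays the role of a conditional expectation given \<open>F n\<close>. Events of
  \<open>F n\<close> are preimages under \<open>past n\<close>, so \<open>prob_past_step_eq\<close>
  makes \<open>Z\<close> independent of the next step and the integrals multiply.\<close>

lemma integral_past_step:
  fixes g :: "real ^ 'd \<Rightarrow> complex"
  assumes g [measurable]: "g \<in> borel_measurable borel" and g1: "\<And>x. norm (g x) \<le> 1" and v: "v \<le> n"
    and Z: "Z \<in> borel_measurable (F n)" and Z1: "\<And>\<omega>. \<omega> \<in> space M \<Longrightarrow> norm (Z \<omega>) \<le> b"
  shows "(\<integral>\<omega>. Z \<omega> * (indicator {v} (par n \<omega>) * g (\<eta> (Suc n) \<omega>)) \<partial>M) =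
    (\<integral>\<omega>. Z \<omega> \<partial>M) * (p n v * (\<integral>x. g x \<partial>\<L>))"
proof -
  have Z_meas [measurable]: "Z \<in> borel_measurable M"
    using measurable_from_subalg[OF subalgebra_F Z] .
  let ?Y = "\<lambda>\<omega>. indicator {v} (par n \<omega>) * g (\<eta> (Suc n) \<omega>)"
  have "(\<lambda>\<omega>. indicator {v} (par n \<omega>) :: complex) \<in> borel_measurable M"
    by (rule measurable_compose[OF par_meas]) simp
  then have Y_meas: "?Y \<in> borel_measurable M"
    using measurable_compose[OF \<eta>_meas g] by (rule borel_measurable_times)
  have iv: "indep_var borel Z borel ?Y"
  proof (rule indep_var_borelI[OF Z_meas Y_meas])
    fix A B :: "complex set" assume AB: "A \<in> sets borel" "B \<in> sets borel"
    obtain D where D: "D \<in> sets (past_space n)" "Z -` A \<inter> space M = past n -` D \<inter> space M"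
      using measurable_sets[OF Z AB(1)] by (auto simp: sets_F space_F)
    define E where "E = (\<lambda>y. indicator {v} (fst y) * g (snd y)) -` B \<inter> space (count_space (UNIV :: nat set) \<Otimes>\<^sub>M borel)"
    have E: "E \<in> sets (count_space UNIV \<Otimes>\<^sub>M borel)"
      unfolding E_def
      by (intro measurable_sets[OF _ AB(2)] borel_measurable_times measurable_compose[OF measurable_snd g]
          measurable_compose[OF measurable_fst]) simp
    have ZD: "Z \<omega> \<in> A \<longleftrightarrow> past n \<omega> \<in> D" if "\<omega> \<in> space M" for \<omega>
      using D(2) that by blast
    have YE: "?Y \<omega> \<in> B \<longleftrightarrow> (par n \<omega>, \<eta> (Suc n) \<omega>) \<in> E" for \<omega>
      by (simp add: E_def space_pair_measure)
    have "prob {\<omega> \<in> space M. Z \<omega> \<in> A \<and> ?Y \<omega> \<in> B} =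
        prob {\<omega> \<in> space M. past n \<omega> \<in> D \<and> (par n \<omega>, \<eta> (Suc n) \<omega>) \<in> E}"
      unfolding YE by (rule arg_cong[where f=prob]) (use ZD in blast)
    also have "\<dots> = prob {\<omega> \<in> space M. past n \<omega> \<in> D} * prob {\<omega> \<in> space M. (par n \<omega>, \<eta> (Suc n) \<omega>) \<in> E}"
      unfolding prob_next[OF E] by (rule prob_past_step_eq[OF D(1) E])
    also have "{\<omega> \<in> space M. past n \<omega> \<in> D} = {\<omega> \<in> space M. Z \<omega> \<in> A}"
      using ZD by blast
    finally show "prob {\<omega> \<in> space M. Z \<omega> \<in> A \<and> ?Y \<omega> \<in> B} =
        prob {\<omega> \<in> space M. Z \<omega> \<in> A} * prob {\<omega> \<in> space M. ?Y \<omega> \<in> B}"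
      unfolding YE .
  qed
  have i1: "integrable M Z"
    by (rule integrable_const_bound[where B=b]) (auto intro: Z1)
  have i2: "integrable M ?Y"
    by (rule integrable_const_bound[where B=1]) (use Y_meas in \<open>auto simp: g1 indicator_def\<close>)
  show ?thesis
    using indep_var_lebesgue_integral[OF iv i1 i2] integral_par_\<eta>[OF g g1 v] by simp
qed

section \<open>The empirical characteristic function and its martingale\<close>

lemma prob_space_\<L>: "prob_space \<L>"
  unfolding \<eta>_law[of 0, symmetric] by (rule prob_space_distr) simp

lemma sets_\<L>: "sets \<L> = sets borel"
  unfolding \<eta>_law[of 0, symmetric] by simp

definition \<phi> :: "real ^ 'd \<Rightarrow> complex" where
  "\<phi> t = (\<integral>x. iexp (t \<bullet> x) \<partial>\<L>)"

definition wave :: "real ^ 'd \<Rightarrow> nat \<Rightarrow> 'a \<Rightarrow> complex" where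
  "wave t v \<omega> = iexp (t \<bullet> X v \<omega>)"

text \<open>In the opening notation this is \<open>A\<^sub>n(t)\<close>; the positions are not
  rescaled.\<close>

definition ecf :: "real ^ 'd \<Rightarrow> nat \<Rightarrow> 'a \<Rightarrow> complex" where
  "ecf t n \<omega> = (\<Sum>v\<le>n. p n v * wave t v \<omega>)"

lemma norm_\<phi>: "norm (\<phi> t) \<le> 1"
proof -
  interpret L: prob_space \<L> by (rule prob_space_\<L>)
  have "norm (\<phi> t) \<le> (\<integral>x. norm (iexp (t \<bullet> x)) \<partial>\<L>)"
    unfolding \<phi>_def by (rule integral_norm_bound)
  then show ?thesis using L.prob_space by simp
qed

lemma norm_wave [simp]: "norm (wave t v \<omega>) = 1"
  by (simp add: wave_def)

lemma norm_ecf: "norm (ecf t n \<omega>) \<le> 1"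
proof -
  have "norm (ecf t n \<omega>) \<le> (\<Sum>v\<le>n. norm (p n v * wave t v \<omega>))"
    unfolding ecf_def by (rule norm_sum)
  also have "\<dots> = (\<Sum>v\<le>n. p n v)"
    by (simp only: norm_mult norm_of_real norm_wave abs_of_nonneg[OF p_nonneg] mult_1_right)
  finally show ?thesis by (simp add: sum_p)
qed

lemma wave_meas_F: "v \<le> n \<Longrightarrow> wave t v \<in> borel_measurable (F n)"
  using X_meas_F unfolding wave_def by measurable

lemma wave_meas [measurable]: "wave t v \<in> borel_measurable M"
  unfolding wave_def by measurable

lemma ecf_meas_F: "ecf t n \<in> borel_measurable (F n)"
  unfolding ecf_def by (intro borel_measurable_sum borel_measurable_times wave_meas_F) auto

lemma ecf_meas [measurable]: "ecf t n \<in> borel_measurable M"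
  unfolding ecf_def by measurable

lemma integrable_bounded:
  fixes f :: "'a \<Rightarrow> complex"
  assumes "f \<in> borel_measurable M" "\<And>\<omega>. \<omega> \<in> space M \<Longrightarrow> norm (f \<omega>) \<le> b"
  shows "integrable M f"
  using assms by (intro integrable_const_bound[where B=b]) auto

text \<open>Splitting by the parent makes each summand a product of a factor from the past and a
  factor of the next step, as \<open>integral_past_step\<close> requires.\<close>

lemma wave_Suc:
  assumes "\<omega> \<in> space M"
  shows "wave t (Suc n) \<omega> = (\<Sum>v\<le>n. wave t v \<omega> * (indicator {v} (par n \<omega>) * iexp (t \<bullet> \<eta> (Suc n) \<omega>)))"
proof -
  have "(\<Sum>v\<le>n. wave t v \<omega> * (indicator {v} (par n \<omega>) * iexp (t \<bullet> \<eta> (Suc n) \<omega>))) =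
      (\<Sum>v\<le>n. if v = par n \<omega> then wave t v \<omega> * iexp (t \<bullet> \<eta> (Suc n) \<omega>) else 0)"
    by (intro sum.cong) auto
  also have "\<dots> = wave t (par n \<omega>) \<omega> * iexp (t \<bullet> \<eta> (Suc n) \<omega>)"
    using par_le[OF assms] by (simp add: sum.delta)
  also have "\<dots> = wave t (Suc n) \<omega>"
    by (simp add: wave_def X_Suc assms inner_add_right distrib_left exp_add)
  finally show ?thesis by simp
qed

text \<open>The new node has weight 1, so it pulls the weighted mean towards its own value by the
  reciprocal of the new total weight.\<close>

lemma ecf_Suc: "ecf t (Suc n) \<omega> = ecf t n \<omega> + (wave t (Suc n) \<omega> - ecf t n \<omega>) / (real n + 1 + \<rho>)"
proof -
  define S where "S = (\<Sum>v\<le>n. node_weight \<rho> v * wave t v \<omega>)"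
  have 1: "ecf t n \<omega> = S / (real n + \<rho>)"
    by (simp add: ecf_def S_def total_weight_eq sum_divide_distrib)
  have 2: "ecf t (Suc n) \<omega> = (S + wave t (Suc n) \<omega>) / (real n + 1 + \<rho>)"
    by (simp add: ecf_def S_def total_weight_eq sum_divide_distrib add_divide_distrib node_weight_def add_ac)
  have "complex_of_real (real n + \<rho>) \<noteq> 0" "complex_of_real (real n + 1 + \<rho>) \<noteq> 0"
    using \<rho> by (simp_all only: of_real_eq_0_iff)
  moreover have "complex_of_real (real n + 1 + \<rho>) = complex_of_real (real n + \<rho>) + 1" by simp
  ultimately show ?thesis unfolding 1 2
    by (simp add: divide_simps del: of_real_add) (simp add: algebra_simps del: of_real_add)
qed

lemma ecf_0: "\<omega> \<in> space M \<Longrightarrow> ecf t 0 \<omega> = 1"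
  using \<rho> by (simp add: ecf_def wave_def X_0 node_weight_def total_weight_eq)

text \<open>The parent is drawn with the very weights that define the empirical distribution. Hence,
  given the past, the parent's wave averages to \<open>ecf t n\<close>, and the new offset
  contributes the factor \<open>\<phi> t\<close>.\<close>

lemma integral_wave_Suc:
  assumes Z: "Z \<in> borel_measurable (F n)" and Z1: "\<And>\<omega>. \<omega> \<in> space M \<Longrightarrow> norm (Z \<omega>) \<le> b"
  shows "(\<integral>\<omega>. Z \<omega> * wave t (Suc n) \<omega> \<partial>M) = \<phi> t * (\<integral>\<omega>. Z \<omega> * ecf t n \<omega> \<partial>M)"
proof -
  note [measurable] = measurable_from_subalg[OF subalgebra_F Z]
  let ?Y = "\<lambda>v \<omega>. indicator {v} (par n \<omega>) * iexp (t \<bullet> \<eta> (Suc n) \<omega>)"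
  have i: "integrable M (\<lambda>\<omega>. Z \<omega> * wave t v \<omega> * ?Y v \<omega>)" for v
  proof (rule integrable_bounded)
    show "norm (Z \<omega> * wave t v \<omega> * ?Y v \<omega>) \<le> b" if "\<omega> \<in> space M" for \<omega>
      using Z1[OF that] order_trans[OF norm_ge_zero Z1[OF that]] by (auto simp: norm_mult indicator_def)
    have [measurable]: "(\<lambda>\<omega>. indicator {v} (par n \<omega>) :: complex) \<in> borel_measurable M"
      by (rule measurable_compose[OF par_meas]) simp
    show "(\<lambda>\<omega>. Z \<omega> * wave t v \<omega> * ?Y v \<omega>) \<in> borel_measurable M" by measurable
  qed
  have i': "integrable M (\<lambda>\<omega>. Z \<omega> * wave t v \<omega>)" for v
    using Z1 by (intro integrable_bounded[where b=b]) (auto simp: norm_mult)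
  have "(\<integral>\<omega>. Z \<omega> * wave t (Suc n) \<omega> \<partial>M) = (\<integral>\<omega>. (\<Sum>v\<le>n. Z \<omega> * wave t v \<omega> * ?Y v \<omega>) \<partial>M)"
    by (intro Bochner_Integration.integral_cong) (simp_all add: wave_Suc sum_distrib_left mult_ac)
  also have "\<dots> = (\<Sum>v\<le>n. \<integral>\<omega>. Z \<omega> * wave t v \<omega> * ?Y v \<omega> \<partial>M)"
    using i by simp
  also have "\<dots> = (\<Sum>v\<le>n. (\<integral>\<omega>. Z \<omega> * wave t v \<omega> \<partial>M) * (p n v * \<phi> t))"
  proof (rule sum.cong[OF refl])
    fix v assume "v \<in> {..n}"
    then have v: "v \<le> n" by simp
    show "(\<integral>\<omega>. Z \<omega> * wave t v \<omega> * ?Y v \<omega> \<partial>M) = (\<integral>\<omega>. Z \<omega> * wave t v \<omega> \<partial>M) * (p n v * \<phi> t)"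
      unfolding \<phi>_def
      by (rule integral_past_step[where b=b])
        (use v Z Z1 wave_meas_F in \<open>auto simp: norm_mult intro!: borel_measurable_times\<close>)
  qed
  also have "\<dots> = \<phi> t * (\<Sum>v\<le>n. p n v * (\<integral>\<omega>. Z \<omega> * wave t v \<omega> \<partial>M))"
    by (simp add: sum_distrib_left mult_ac)
  also have "(\<Sum>v\<le>n. p n v * (\<integral>\<omega>. Z \<omega> * wave t v \<omega> \<partial>M)) = (\<integral>\<omega>. (\<Sum>v\<le>n. p n v * (Z \<omega> * wave t v \<omega>)) \<partial>M)"
    using i' by simp
  also have "\<dots> = (\<integral>\<omega>. Z \<omega> * ecf t n \<omega> \<partial>M)"
    by (simp add: ecf_def sum_distrib_left mult_ac)
  finally show ?thesis .
qed

lemma integral_innovation: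
  assumes Z: "Z \<in> borel_measurable (F n)" and Z1: "\<And>\<omega>. \<omega> \<in> space M \<Longrightarrow> norm (Z \<omega>) \<le> b"
  shows "(\<integral>\<omega>. Z \<omega> * (wave t (Suc n) \<omega> - \<phi> t * ecf t n \<omega>) \<partial>M) = 0"
proof -
  note [measurable] = measurable_from_subalg[OF subalgebra_F Z]
  have "integrable M (\<lambda>\<omega>. Z \<omega> * wave t (Suc n) \<omega>)"
    using Z1 by (intro integrable_bounded[where b=b]) (auto simp: norm_mult)
  moreover have "integrable M (\<lambda>\<omega>. Z \<omega> * ecf t n \<omega>)"
  proof (rule integrable_bounded[where b=b])
    show "norm (Z \<omega> * ecf t n \<omega>) \<le> b" if "\<omega> \<in> space M" for \<omega>
      using mult_mono[OF Z1[OF that] norm_ecf[of t n \<omega>]] order_trans[OF norm_ge_zero Z1[OF that]]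
      by (simp add: norm_mult)
  qed measurable
  moreover have "(\<integral>\<omega>. Z \<omega> * (wave t (Suc n) \<omega> - \<phi> t * ecf t n \<omega>) \<partial>M) =
      (\<integral>\<omega>. Z \<omega> * wave t (Suc n) \<omega> - \<phi> t * (Z \<omega> * ecf t n \<omega>) \<partial>M)"
    by (simp add: algebra_simps)
  ultimately show ?thesis using integral_wave_Suc[OF Z Z1, of t] by simp
qed

text \<open>The coefficient of \<open>ecf t n\<close> is the next factor of
  \<open>mean_factor\<close>, and the remainder is orthogonal to the past by
  \<open>integral_innovation\<close>; hence division by \<open>mean_factor\<close> yields a
  martingale.\<close>

lemma ecf_Suc_innovation:
  "ecf t (Suc n) \<omega> = (1 - (1 - \<phi> t) / (real n + 1 + \<rho>)) * ecf t n \<omega> +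
    (wave t (Suc n) \<omega> - \<phi> t * ecf t n \<omega>) / (real n + 1 + \<rho>)"
  unfolding ecf_Suc by (simp add: diff_divide_distrib algebra_simps)

lemma integral_ecf: "(\<integral>\<omega>. ecf t n \<omega> \<partial>M) = mean_factor \<rho> (\<phi> t) n"
proof (induction n)
  case 0
  have "(\<integral>\<omega>. ecf t 0 \<omega> \<partial>M) = (\<integral>\<omega>. 1 \<partial>M)"
    by (intro Bochner_Integration.integral_cong) (simp_all add: ecf_0)
  then show ?case using prob_space by (simp add: mean_factor_def)
next
  case (Suc n)
  have i: "integrable M (ecf t n)" "integrable M (wave t (Suc n))"
    by (auto intro!: integrable_bounded[where b=1] norm_ecf)
  have "(\<integral>\<omega>. wave t (Suc n) \<omega> - \<phi> t * ecf t n \<omega> \<partial>M) = 0"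
    using integral_innovation[of "\<lambda>_. 1" n 1 t] by simp
  then have "(\<integral>\<omega>. ecf t (Suc n) \<omega> \<partial>M) = (1 - (1 - \<phi> t) / (real n + 1 + \<rho>)) * (\<integral>\<omega>. ecf t n \<omega> \<partial>M)"
    unfolding ecf_Suc_innovation using i by simp
  then show ?case using Suc by (simp add: mean_factor_def)
qed

text \<open>The bound has to vanish as \<open>\<phi> t\<close> tends to 1. The new wave minus 1 is
  the orthogonal sum of the innovation and \<open>\<phi> t * ecf t n - 1\<close>, so by Pythagoras
  its mean square dominates that of the innovation. As the wave has modulus 1, this mean square is
  twice the real part of 1 minus the mean of the wave.\<close>

lemma integral_innovation_square:
  "(\<integral>\<omega>. (norm (wave t (Suc n) \<omega> - \<phi> t * ecf t n \<omega>))\<^sup>2 \<partial>M) \<le> 2 * (1 + harm n) * norm (1 - \<phi> t)"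
proof -
  define D where "D = (\<lambda>\<omega>. wave t (Suc n) \<omega> - \<phi> t * ecf t n \<omega>)"
  define Z where "Z = (\<lambda>\<omega>. cnj (\<phi> t * ecf t n \<omega> - 1))"
  have "norm (\<phi> t * ecf t n \<omega>) \<le> 1" for \<omega>
    using mult_mono[OF norm_\<phi>[of t] norm_ecf[of t n \<omega>]] by (simp add: norm_mult)
  then have D2: "norm (D \<omega>) \<le> 2" and Z2: "norm (Z \<omega>) \<le> 2" for \<omega>
    unfolding D_def Z_def complex_mod_cnj
    by (auto intro!: order_trans[OF norm_triangle_ineq4] simp: add_mono[of _ 1 _ 1, simplified])
  have [measurable]: "cnj \<in> borel_measurable borel"
    by (intro borel_measurable_continuous_onI continuous_intros)
  have Z: "Z \<in> borel_measurable (F n)"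
    using ecf_meas_F[of t n] unfolding Z_def by measurable
  have [measurable]: "D \<in> borel_measurable M" "Z \<in> borel_measurable M"
    unfolding D_def Z_def by measurable
  have iD: "integrable M (\<lambda>\<omega>. (norm (D \<omega>))\<^sup>2)"
    using power_mono[OF D2 norm_ge_zero, where n=2] by (intro integrable_const_bound[where B=4]) auto
  have iW: "integrable M (wave t (Suc n))" by (auto intro!: integrable_bounded[where b=1])
  have iZD: "integrable M (\<lambda>\<omega>. Z \<omega> * D \<omega>)"
    using mult_mono[OF Z2 D2] by (intro integrable_bounded[where b=4]) (auto simp: norm_mult)
  have ZD0: "(\<integral>\<omega>. Re (Z \<omega> * D \<omega>) \<partial>M) = 0"
    using integral_Re[OF iZD] integral_innovation[OF Z Z2, of t] by (simp add: D_def)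
  have "(norm (D \<omega>))\<^sup>2 \<le> (2 - 2 * Re (wave t (Suc n) \<omega>)) - 2 * Re (Z \<omega> * D \<omega>)" for \<omega>
  proof -
    have eq: "(norm (a - 1))\<^sup>2 = (norm (a - b))\<^sup>2 + (norm (b - 1))\<^sup>2 + 2 * Re (cnj (b - 1) * (a - b))" for a b
      unfolding cmod_power2 by (simp add: power2_eq_square algebra_simps)
    have w: "(norm (wave t (Suc n) \<omega> - 1))\<^sup>2 = 2 - 2 * Re (wave t (Suc n) \<omega>)"
      using norm_wave[of t "Suc n" \<omega>] unfolding cmod_power2 
      by (simp add: cmod_def power2_eq_square algebra_simps)
    show ?thesis
      using eq[of "wave t (Suc n) \<omega>" "\<phi> t * ecf t n \<omega>"] zero_le_power2[of "norm (\<phi> t * ecf t n \<omega> - 1)"]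
      unfolding w D_def Z_def by linarith
  qed
  then have "(\<integral>\<omega>. (norm (D \<omega>))\<^sup>2 \<partial>M) \<le> (\<integral>\<omega>. (2 - 2 * Re (wave t (Suc n) \<omega>)) - 2 * Re (Z \<omega> * D \<omega>) \<partial>M)"
    by (intro integral_mono iD Bochner_Integration.integrable_diff integrable_mult_right integrable_const
        integrable_Re[OF iW] integrable_Re[OF iZD])
  also have "\<dots> = 2 - 2 * (\<integral>\<omega>. Re (wave t (Suc n) \<omega>) \<partial>M) - 2 * (\<integral>\<omega>. Re (Z \<omega> * D \<omega>) \<partial>M)"
    using integrable_Re[OF iW] integrable_Re[OF iZD] prob_space by (simp del: times_complex.sel)
  also have "\<dots> = 2 * Re (1 - (\<integral>\<omega>. wave t (Suc n) \<omega> \<partial>M))"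
    unfolding ZD0 integral_Re[OF iW] by simp
  also have "(\<integral>\<omega>. wave t (Suc n) \<omega> \<partial>M) = \<phi> t * mean_factor \<rho> (\<phi> t) n"
    using integral_wave_Suc[of "\<lambda>_. 1" n 1 t] by (simp add: integral_ecf)
  also have "2 * Re (1 - \<phi> t * mean_factor \<rho> (\<phi> t) n) \<le> 2 * norm (1 - \<phi> t * mean_factor \<rho> (\<phi> t) n)"
    by (simp add: complex_Re_le_cmod del: minus_complex.sel)
  also have "1 - \<phi> t * mean_factor \<rho> (\<phi> t) n = (1 - \<phi> t) + \<phi> t * (1 - mean_factor \<rho> (\<phi> t) n)"
    by (simp add: algebra_simps)
  also have "norm \<dots> \<le> norm (1 - \<phi> t) + norm (\<phi> t) * norm (1 - mean_factor \<rho> (\<phi> t) n)"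
    by (metis norm_mult norm_triangle_ineq)
  also have "norm (\<phi> t) * norm (1 - mean_factor \<rho> (\<phi> t) n) \<le> 1 * (norm (1 - \<phi> t) * harm n)"
    using norm_\<phi> \<rho> by (intro mult_mono norm_one_minus_mean_factor_le) auto
  finally show ?thesis unfolding D_def by (simp add: algebra_simps)
qed

text \<open>The maximal inequality is applied to the quotient of \<open>ecf\<close> by its mean.
  Closeness of \<open>\<phi> t\<close> to 1 keeps the mean from decaying fast, which makes the
  increment variances summable.\<close>

lemma ecf_maximal_inequality:
  assumes t: "norm (1 - \<phi> t) \<le> 1 / 8" and "e > 0"
  shows "prob {\<omega> \<in> space M. \<exists>n. e \<le> norm (ecf t n \<omega> - mean_factor \<rho> (\<phi> t) n)} \<le>
    suminf variance_term * norm (1 - \<phi> t) / e\<^sup>2"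
proof -
  define q where "q = mean_factor \<rho> (\<phi> t)"
  define W where "W = (\<lambda>n \<omega>. ecf t n \<omega> / q n)"
  define D where "D = (\<lambda>n \<omega>. wave t (Suc n) \<omega> - \<phi> t * ecf t n \<omega>)"
  have q0: "q n \<noteq> 0" for n
  proof -
    have "0 < 1 / sqrt (real n + 1)" by simp
    then have "0 < (norm (q n))\<^sup>2"
      using norm_mean_factor_ge[OF \<rho> t, of n] unfolding q_def by linarith
    then show ?thesis by auto
  qed
  have q1: "norm (q n) \<le> 1" for n
    unfolding q_def using \<rho> norm_\<phi> by (rule norm_mean_factor_le)
  have W_0: "W 0 \<omega> = 1" if "\<omega> \<in> space M" for \<omega>
    using that by (simp add: W_def ecf_0 q_def mean_factor_def)
  have W_diff: "W (Suc n) \<omega> - W n \<omega> = D n \<omega> / ((real n + 1 + \<rho>) * q (Suc n))" for n \<omega>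
  proof -
    define z where "z = 1 - (1 - \<phi> t) / (real n + 1 + \<rho>)"
    have q_Suc: "q (Suc n) = q n * z" by (simp add: q_def mean_factor_def z_def)
    with q0[of "Suc n"] q0[of n] have "z \<noteq> 0" by auto
    have "W (Suc n) \<omega> - W n \<omega> = (z * ecf t n \<omega> + D n \<omega> / (real n + 1 + \<rho>)) / (q n * z) - ecf t n \<omega> / q n"
      unfolding W_def ecf_Suc_innovation q_Suc by (simp add: D_def z_def)
    also have "\<dots> = D n \<omega> / (real n + 1 + \<rho>) / (q n * z)"
      using \<open>z \<noteq> 0\<close> q0[of n] by (simp add: add_divide_distrib)
    finally show ?thesis by (simp add: q_Suc)
  qed
  have "prob {\<omega> \<in> space M. \<exists>n. e \<le> norm (W n \<omega> - W 0 \<omega>)} \<le> suminf variance_term * norm (1 - \<phi> t) / e\<^sup>2"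
  proof (rule martingale_maximal_inequality[where F=F and B="\<lambda>n. 1 / norm (q n)"])
    show "W n \<in> borel_measurable (F n)" for n
      using ecf_meas_F unfolding W_def by measurable
    show "norm (W n \<omega>) \<le> 1 / norm (q n)" for n \<omega>
      unfolding W_def norm_divide by (intro divide_right_mono norm_ecf) auto
    show "(\<integral>\<omega>. Z \<omega> * (W (Suc n) \<omega> - W n \<omega>) \<partial>M) = 0"
      if "Z \<in> borel_measurable (F n)" "\<And>\<omega>. \<omega> \<in> space M \<Longrightarrow> norm (Z \<omega>) \<le> b" for n Z b
    proof -
      have "(\<integral>\<omega>. Z \<omega> * (W (Suc n) \<omega> - W n \<omega>) \<partial>M) =
          (\<integral>\<omega>. Z \<omega> * D n \<omega> / ((real n + 1 + \<rho>) * q (Suc n)) \<partial>M)"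
        unfolding W_diff by simp
      also have "\<dots> = 0" using integral_innovation[OF that, of t] by (simp add: D_def)
      finally show ?thesis .
    qed
    show "(\<Sum>k<n. \<integral>\<omega>. (norm (W (Suc k) \<omega> - W k \<omega>))\<^sup>2 \<partial>M) \<le> suminf variance_term * norm (1 - \<phi> t)" for n
    proof -
      have "(\<integral>\<omega>. (norm (W (Suc k) \<omega> - W k \<omega>))\<^sup>2 \<partial>M) \<le> variance_term k * norm (1 - \<phi> t)" for k
      proof -
        have *: "(norm (W (Suc k) \<omega> - W k \<omega>))\<^sup>2 = 1 / ((real k + 1 + \<rho>)\<^sup>2 * (norm (q (Suc k)))\<^sup>2) * (norm (D k \<omega>))\<^sup>2" for \<omega>
        proof -
          have "norm (complex_of_real (real k + 1 + \<rho>)) = real k + 1 + \<rho>"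
            using \<rho> by (simp only: norm_of_real abs_of_nonneg)
          then show ?thesis unfolding W_diff norm_divide norm_mult
            by (simp add: power_divide power_mult_distrib)
        qed
        have "1 / ((real k + 1 + \<rho>)\<^sup>2 * (norm (q (Suc k)))\<^sup>2) \<le> sqrt (real k + 2) / (real k + 1)\<^sup>2"
        proof -
          have "1 / ((real k + 1 + \<rho>)\<^sup>2 * (norm (q (Suc k)))\<^sup>2) \<le> 1 / ((real k + 1)\<^sup>2 * (1 / sqrt (real (Suc k) + 1)))"
            using \<rho> norm_mean_factor_ge[OF \<rho> t, of "Suc k"] unfolding q_def
            by (intro divide_left_mono mult_mono power_mono mult_pos_pos) (auto intro: order_less_le_trans)
          then show ?thesis by (simp add: add_ac)
        qed
        then have "1 / ((real k + 1 + \<rho>)\<^sup>2 * (norm (q (Suc k)))\<^sup>2) * (\<integral>\<omega>. (norm (D k \<omega>))\<^sup>2 \<partial>M) \<le>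
            sqrt (real k + 2) / (real k + 1)\<^sup>2 * (2 * (1 + harm k) * norm (1 - \<phi> t))"
          using integral_innovation_square[of t k] unfolding D_def by (intro mult_mono) auto
        then show ?thesis unfolding * by (simp add: variance_term_def mult_ac)
      qed
      then have "(\<Sum>k<n. \<integral>\<omega>. (norm (W (Suc k) \<omega> - W k \<omega>))\<^sup>2 \<partial>M) \<le> (\<Sum>k<n. variance_term k * norm (1 - \<phi> t))"
        by (rule sum_mono)
      also have "\<dots> = (\<Sum>k<n. variance_term k) * norm (1 - \<phi> t)" by (simp add: sum_distrib_right)
      also have "\<dots> \<le> suminf variance_term * norm (1 - \<phi> t)"
        by (intro mult_right_mono sum_le_suminf summable_variance_term) (auto simp: variance_term_nonneg)
      finally show ?thesis .
    qed
  qed (use subalgebra_F sets_F_mono \<open>e > 0\<close> in auto)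
  moreover have "prob {\<omega> \<in> space M. \<exists>n. e \<le> norm (ecf t n \<omega> - q n)} \<le> prob {\<omega> \<in> space M. \<exists>n. e \<le> norm (W n \<omega> - W 0 \<omega>)}"
  proof (rule finite_measure_mono)
    \<comment> \<open>Multiplying back by \<open>q n\<close> does not enlarge the deviation, since
      \<open>norm (q n) \<le> 1\<close>.\<close>
    have "norm (ecf t n \<omega> - q n) \<le> norm (W n \<omega> - W 0 \<omega>)" if "\<omega> \<in> space M" for n \<omega>
    proof -
      have "ecf t n \<omega> - q n = q n * (W n \<omega> - W 0 \<omega>)"
        unfolding W_0[OF that] using q0[of n] by (simp add: W_def right_diff_distrib)
      then show ?thesis using mult_right_mono[OF q1 norm_ge_zero] by (simp add: norm_mult)
    qed
    then show "{\<omega> \<in> space M. \<exists>n. e \<le> norm (ecf t n \<omega> - q n)} \<subseteq> {\<omega> \<in> space M. \<exists>n. e \<le> norm (W n \<omega> - W 0 \<omega>)}"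
      by (blast intro: order_trans)
    have "W n \<in> borel_measurable M" for n unfolding W_def by measurable
    then show "{\<omega> \<in> space M. \<exists>n. e \<le> norm (W n \<omega> - W 0 \<omega>)} \<in> events" by measurable
  qed
  ultimately show ?thesis unfolding q_def by linarith
qed

end

section \<open>The Gaussian limit\<close>

text \<open>Testing with the radii \<open>inverse (real (Suc k))\<close> expresses convergence by
  countably many measurable conditions. The Fubini argument over frequencies needs this set to be
  measurable.\<close>

lemma measurable_tendsto_pred:
  fixes f :: "nat \<Rightarrow> 'a \<Rightarrow> 'b :: {metric_space, second_countable_topology}"
  assumes [measurable]: "\<And>n. f n \<in> borel_measurable N" "g \<in> borel_measurable N"
  shows "{z \<in> space N. (\<lambda>n. f n z) \<longlonglongrightarrow> g z} \<in> sets N"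
proof -
  have "(\<lambda>n. f n z) \<longlonglongrightarrow> g z \<longleftrightarrow> (\<forall>k. \<exists>no. \<forall>n\<ge>no. dist (f n z) (g z) < inverse (real (Suc k)))" for z
  proof
    assume "(\<lambda>n. f n z) \<longlonglongrightarrow> g z"
    then show "\<forall>k. \<exists>no. \<forall>n\<ge>no. dist (f n z) (g z) < inverse (real (Suc k))"
      unfolding lim_sequentially by simp
  next
    assume *: "\<forall>k. \<exists>no. \<forall>n\<ge>no. dist (f n z) (g z) < inverse (real (Suc k))"
    show "(\<lambda>n. f n z) \<longlonglongrightarrow> g z"
      unfolding lim_sequentially
    proof (intro allI impI)
      fix e :: real assume "e > 0"
      then obtain k where "inverse (real (Suc k)) < e" using reals_Archimedean by blast
      with * show "\<exists>no. \<forall>n\<ge>no. dist (f n z) (g z) < e" by (meson less_trans)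
    qed
  qed
  then show ?thesis by simp
qed

lemma countable_rational_vectors: "countable {u :: real ^ 'd. \<forall>i. u $ i \<in> \<rat>}"
proof -
  have "{u :: real ^ 'd. \<forall>i. u $ i \<in> \<rat>} \<subseteq> vec_lambda ` (PiE UNIV (\<lambda>_. \<rat>))"
  proof
    fix u :: "real ^ 'd" assume "u \<in> {u. \<forall>i. u $ i \<in> \<rat>}"
    then show "u \<in> vec_lambda ` (PiE UNIV (\<lambda>_. \<rat>))"
      by (intro image_eqI[of _ _ "vec_nth u"]) auto
  qed
  moreover have "countable (PiE (UNIV :: 'd set) (\<lambda>_. \<rat> :: real set))"
    by (intro countable_PiE countable_rat) auto
  ultimately show ?thesis by (meson countable_image countable_subset)
qed

section \<open>Rescaled empirical distributions\<close>

lemma sets_rescale [simp]: "sets (rescale a b \<mu>) = sets borel"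
  by (simp add: rescale_def)

lemma affine_meas: "(\<lambda>x :: 'v :: euclidean_space. (x - b) /\<^sub>R a) \<in> borel_measurable borel"
  by measurable

lemma prob_space_empirical_dist:
  assumes "\<rho> > 0"
  shows "prob_space (empirical_dist \<rho> n x)"
proof (rule prob_spaceI)
  have "emeasure (empirical_dist \<rho> n x) UNIV = 1"
    using emeasure_empirical_dist[OF assms, of UNIV n x] assms total_weight_eq[of \<rho> n]
    by (simp add: total_weight_def)
  then show "emeasure (empirical_dist \<rho> n x) (space (empirical_dist \<rho> n x)) = 1"
    by (simp add: empirical_dist_def)
qed

lemma prob_space_rescale_empirical:
  fixes b :: "'v :: euclidean_space"
  assumes "\<rho> > 0"
  shows "prob_space (rescale a b (empirical_dist \<rho> n x))"
  unfolding rescale_def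
  by (intro prob_space.prob_space_distr prob_space_empirical_dist assms)
    (simp add: empirical_dist_def affine_meas)

lemma integral_rescale_empirical:
  fixes f :: "'v :: euclidean_space \<Rightarrow> complex"
  assumes "\<rho> > 0" and f: "f \<in> borel_measurable borel"
  shows "(\<integral>y. f y \<partial>rescale a b (empirical_dist \<rho> n x)) =
    (\<Sum>v\<le>n. of_real (node_weight \<rho> v / total_weight \<rho> n) * f ((x v - b) /\<^sub>R a))"
proof -
  have "(\<integral>y. f y \<partial>rescale a b (empirical_dist \<rho> n x)) = (\<integral>y. f ((y - b) /\<^sub>R a) \<partial>empirical_dist \<rho> n x)"
    unfolding rescale_def by (intro integral_distr f) (simp add: empirical_dist_def affine_meas)
  also have "\<dots> = (\<integral>v. f ((x v - b) /\<^sub>R a) \<partial>point_measure {..n} (\<lambda>v. ennreal (node_weight \<rho> v / total_weight \<rho> n)))"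
    unfolding empirical_dist_def
    by (intro integral_distr measurable_compose[OF affine_meas f]) simp
  also have "\<dots> = (\<Sum>v\<le>n. (node_weight \<rho> v / total_weight \<rho> n) *\<^sub>R f ((x v - b) /\<^sub>R a))"
    using assms(1) by (intro lebesgue_integral_point_measure_finite) (auto simp: node_weight_def total_weight_eq)
  finally show ?thesis by (simp add: scaleR_conv_of_real)
qed

lemma distr_scaleR_rescale:
  fixes b :: "'v :: euclidean_space"
  assumes "sets \<mu> = sets borel" "a \<noteq> 0"
  shows "distr (rescale a b \<mu>) borel (\<lambda>x. (a / a') *\<^sub>R x) = rescale a' b \<mu>"
proof -
  have "(\<lambda>x. (x - b) /\<^sub>R a) \<in> measurable \<mu> borel"
    by (subst measurable_cong_sets[OF assms(1) refl]) (rule affine_meas)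
  moreover have "a / a' * inverse a = inverse a'"
    using assms(2) by (simp add: divide_inverse)
  ultimately show ?thesis
    unfolding rescale_def by (subst distr_distr) (simp_all add: comp_def)
qed

text \<open>\<open>(log n)\<^sup>1\<^sup>/\<^sup>2\<close> is replaced by \<open>(level n)\<^sup>2\<close> rather than by its integer part because the bounds in the
  Borel--Cantelli argument are of order \<open>1 / (level n)\<^sup>2\<close>.\<close>

definition level :: "nat \<Rightarrow> nat" where
  "level n = nat \<lfloor>ln (real n) powr (1 / 4)\<rfloor>"

abbreviation grid_scale :: "nat \<Rightarrow> real" where
  "grid_scale n \<equiv> (real (level n))\<^sup>2"

lemma real_level: "real (level n) = real_of_int \<lfloor>ln (real n) powr (1 / 4)\<rfloor>"
  by (simp add: level_def)

lemma level_at_top: "filterlim level at_top sequentially"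
  unfolding level_def
  by (intro filterlim_compose[OF filterlim_nat_sequentially] filterlim_compose[OF filterlim_floor_sequentially])
    real_asymp

lemma scale_asymp: "(\<lambda>n. grid_scale n / sqrt (ln (real n))) \<longlonglongrightarrow> 1"
  unfolding real_level by real_asymp

lemma ln_scale_asymp: "(\<lambda>n. ln (real n) / (grid_scale n)\<^sup>2) \<longlonglongrightarrow> 1"
  unfolding real_level by real_asymp

lemma inverse_scale_tendsto_0: "(\<lambda>n. inverse (grid_scale n)) \<longlonglongrightarrow> 0"
  unfolding real_level by real_asymp

lemma eventually_scale_pos: "\<forall>\<^sub>F n in sequentially. 0 < grid_scale n"
  unfolding real_level by real_asymp

section \<open>Exponential asymptotics of the mean factors\<close>

lemma summable_inverse_squares_Suc: "summable (\<lambda>i. inverse ((real (Suc i))\<^sup>2))"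
  using inverse_power_summable[of 2, where ?'a=real] by (subst summable_Suc_iff) simp

definition log_sum :: "real \<Rightarrow> nat \<Rightarrow> real" where
  "log_sum \<rho> n = (\<Sum>i<n. 1 / (real i + 1 + \<rho>))"

text \<open>The gap to the harmonic sum is a series with terms at most \<open>\<rho>\<close> over a
  square, and the gap from the harmonic sum to the logarithm converges to Euler's constant.\<close>

lemma convergent_log_sum:
  assumes "\<rho> > 0"
  shows "convergent (\<lambda>n. log_sum \<rho> n - ln (real n))"
proof -
  have "summable (\<lambda>i. 1 / (real i + 1 + \<rho>) - inverse (real (Suc i)))"
  proof (rule summable_comparison_test')
    show "summable (\<lambda>i. \<rho> * inverse ((real (Suc i))\<^sup>2))"
      by (intro summable_mult summable_inverse_squares_Suc)
    show "norm (1 / (real i + 1 + \<rho>) - inverse (real (Suc i))) \<le> \<rho> * inverse ((real (Suc i))\<^sup>2)" if "0 \<le> i" for i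
    proof -
      have "inverse (real (Suc i)) - 1 / (real i + 1 + \<rho>) = \<rho> / ((real i + 1) * (real i + 1 + \<rho>))"
        using assms by (simp add: field_simps)
      also have "\<dots> \<le> \<rho> / ((real i + 1) * (real i + 1))"
        using assms by (intro divide_left_mono mult_left_mono) auto
      finally have "inverse (real (Suc i)) - 1 / (real i + 1 + \<rho>) \<le> \<rho> * inverse ((real (Suc i))\<^sup>2)"
        by (simp add: power2_eq_square field_simps)
      moreover have "1 / (real i + 1 + \<rho>) \<le> inverse (real (Suc i))"
        using assms by (simp add: field_simps)
      ultimately show ?thesis by simp
    qed
  qed
  then have "convergent (\<lambda>n. \<Sum>i<n. 1 / (real i + 1 + \<rho>) - inverse (real (Suc i)))"
    by (simp add: summable_iff_convergent)
  moreover have "harm n = (\<Sum>i<n. inverse (real (Suc i)))" for n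
    unfolding harm_def by (rule sum.atLeast1_atMost_eq[unfolded One_nat_def[symmetric]])
  ultimately have "convergent (\<lambda>n. log_sum \<rho> n - harm n)"
    by (simp add: log_sum_def sum_subtractf)
  from convergent_add[OF this euler_mascheroni_convergent] show ?thesis by simp
qed

text \<open>All factors lie in the unit disc, so the error of the product is at most the sum of the
  errors of \<open>1 - z i\<close> against \<open>exp (- z i)\<close>. These are quadratic in
  \<open>z i\<close>, which makes the bound uniform in \<open>n\<close>; the constant
  \<open>exp 2\<close> reflects \<open>norm (z i) \<le> 2\<close>.\<close>

lemma mean_factor_approx:
  assumes "\<rho> > 0" "norm c \<le> 1"
  shows "norm (mean_factor \<rho> c n - exp (- ((1 - c) * log_sum \<rho> n))) \<le>
    exp 2 * (norm (1 - c))\<^sup>2 * (\<Sum>i. inverse ((real (Suc i))\<^sup>2))"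
proof -
  define z where "z i = (1 - c) / complex_of_real (real i + 1 + \<rho>)" for i
  have nz: "norm (z i) = norm (1 - c) / (real i + 1 + \<rho>)" for i
    unfolding z_def using assms(1) by (intro norm_divide_of_real) simp
  have z_le: "norm (z i) \<le> norm (1 - c) * inverse (real (Suc i))" for i
  proof -
    have "norm (1 - c) / (real i + 1 + \<rho>) \<le> norm (1 - c) / (real i + 1)"
      using assms(1) by (intro divide_left_mono) auto
    then show ?thesis unfolding nz by (simp add: divide_inverse add_ac)
  qed
  have c2: "norm (1 - c) \<le> 2"
    using norm_triangle_ineq4[of 1 c] assms(2) by simp
  have z2: "norm (z i) \<le> 2" for i
  proof -
    have "norm (1 - c) * inverse (real (Suc i)) \<le> 2 * 1"
      using c2 by (intro mult_mono) (auto simp: inverse_le_1_iff)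
    then show ?thesis using z_le[of i] by simp
  qed
  have Re_z: "0 \<le> Re (z i)" for i
    using assms abs_Re_le_cmod[of c] unfolding z_def Re_divide_of_real by (intro divide_nonneg_nonneg) auto
  have "exp (- ((1 - c) * log_sum \<rho> n)) = exp (\<Sum>i<n. - z i)"
    by (simp add: log_sum_def z_def sum_negf sum_distrib_left)
  also have "\<dots> = (\<Prod>i<n. exp (- z i))" by (simp add: exp_sum)
  finally have "norm (mean_factor \<rho> c n - exp (- ((1 - c) * log_sum \<rho> n))) =
      norm ((\<Prod>i<n. 1 - z i) - (\<Prod>i<n. exp (- z i)))"
    by (simp add: mean_factor_def z_def)
  also have "\<dots> \<le> (\<Sum>i<n. norm ((1 - z i) - exp (- z i)))"
  proof (rule norm_prod_diff)
    show "norm (1 - z i) \<le> 1" for i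
      unfolding z_def using assms by (rule norm_mean_factor_step)
    show "norm (exp (- z i)) \<le> 1" for i using Re_z by simp
  qed
  also have "\<dots> \<le> (\<Sum>i<n. exp 2 * (norm (1 - c))\<^sup>2 * inverse ((real (Suc i))\<^sup>2))"
  proof (rule sum_mono)
    fix i
    have "norm ((1 - z i) - exp (- z i)) = norm (exp (- z i) - (\<Sum>k\<le>1. (- z i) ^ k / fact k))"
      by (simp add: norm_minus_commute)
    also have "\<dots> \<le> exp \<bar>Re (- z i)\<bar> * norm (- z i) ^ Suc 1 / fact 1"
      by (rule Taylor_exp)
    also have "\<dots> = exp \<bar>Re (z i)\<bar> * (norm (z i))\<^sup>2" by (simp add: power2_eq_square)
    also have "\<dots> \<le> exp 2 * (norm (1 - c) * inverse (real (Suc i)))\<^sup>2"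
      using z2[of i] abs_Re_le_cmod[of "z i"] z_le[of i] by (intro mult_mono power_mono) auto
    finally show "norm ((1 - z i) - exp (- z i)) \<le> exp 2 * (norm (1 - c))\<^sup>2 * inverse ((real (Suc i))\<^sup>2)"
      by (simp add: power_mult_distrib power_inverse)
  qed
  also have "\<dots> = exp 2 * (norm (1 - c))\<^sup>2 * (\<Sum>i<n. inverse ((real (Suc i))\<^sup>2))"
    by (simp add: sum_distrib_left)
  also have "\<dots> \<le> exp 2 * (norm (1 - c))\<^sup>2 * (\<Sum>i. inverse ((real (Suc i))\<^sup>2))"
    by (intro mult_left_mono sum_le_suminf summable_inverse_squares_Suc) auto
  finally show ?thesis .
qed

locale square_integrable_walk = recursive_tree_walk M \<rho> par \<L> \<eta> X
  for M :: "'a measure" and \<rho> par and \<L> :: "(real ^ 'd) measure" and \<eta> X +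
  assumes moment: "integrable \<L> (\<lambda>x. (norm x)\<^sup>2)"
begin

section \<open>Expansion of the offset's characteristic function at small frequencies\<close>

definition m :: "real ^ 'd" where "m = (\<integral>x. x \<partial>\<L>)"

text \<open>The limit has the raw second moment as its variance because the exponent involves
  \<open>1 - \<phi>\<close> and not the logarithm of \<open>\<phi>\<close>, as for a compound
  Poisson sum.\<close>

definition Q :: "real ^ 'd \<Rightarrow> real" where "Q s = (\<integral>x. (s \<bullet> x)\<^sup>2 \<partial>\<L>)"

sublocale \<L>: prob_space \<L> by (rule prob_space_\<L>)

lemma sets_\<L>_cong [measurable_cong]: "sets \<L> = sets borel"
  by (rule sets_\<L>)

lemma integrable_id: "integrable \<L> (\<lambda>x. x)"
proof (rule Bochner_Integration.integrable_bound)
  show "integrable \<L> (\<lambda>x. 1 + (norm x)\<^sup>2)" using moment by simp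
  have "norm x \<le> 1 + (norm x)\<^sup>2" for x :: "real ^ 'd"
    using zero_le_power2[of "norm x - 1 / 2"] by (simp add: power2_eq_square algebra_simps)
  then show "AE x in \<L>. norm x \<le> norm (1 + (norm x)\<^sup>2)"
    by (intro AE_I2) (metis abs_ge_self order_trans real_norm_def)
qed measurable

lemma integrable_inner: "integrable \<L> (\<lambda>x. s \<bullet> x)"
  using integrable_id by simp

lemma integrable_inner_square: "integrable \<L> (\<lambda>x. (s \<bullet> x)\<^sup>2)"
proof (rule Bochner_Integration.integrable_bound)
  show "integrable \<L> (\<lambda>x. (norm s)\<^sup>2 * (norm x)\<^sup>2)" using moment by simp
  have "(s \<bullet> x)\<^sup>2 \<le> (norm s)\<^sup>2 * (norm x)\<^sup>2" for x
    using power_mono[OF Cauchy_Schwarz_ineq2[of s x] abs_ge_zero, of 2] by (simp add: power_mult_distrib)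
  then show "AE x in \<L>. norm ((s \<bullet> x)\<^sup>2) \<le> norm ((norm s)\<^sup>2 * (norm x)\<^sup>2)" by simp
qed measurable

text \<open>A Taylor expansion under the integral. The first-order remainder estimate gives the
  dominating function \<open>(s \<bullet> x)\<^sup>2 / 2\<close>, integrable by the moment
  assumption, and the second-order estimate gives the pointwise limit.\<close>

lemma \<phi>_expansion:
  assumes r: "r \<longlonglongrightarrow> 0" and r0: "\<forall>\<^sub>F n in sequentially. r n \<noteq> (0 :: real)"
  shows "(\<lambda>n. (\<phi> (r n *\<^sub>R s) - 1 - \<i> * (r n * (s \<bullet> m))) / (r n)\<^sup>2) \<longlonglongrightarrow> of_real (- Q s / 2)"
proof -
  define g where "g = (\<lambda>y h. (iexp (h * y) - 1 - \<i> * of_real (h * y)) / (of_real h)\<^sup>2)"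
  have g_le: "norm (g y h) \<le> y\<^sup>2 / 2" if "h \<noteq> 0" for y h
  proof -
    have "norm (iexp (h * y) - (\<Sum>k\<le>1. (\<i> * of_real (h * y)) ^ k / fact k)) \<le> \<bar>h * y\<bar> ^ Suc 1 / fact (Suc 1)"
      by (rule iexp_approx1)
    moreover have "\<bar>h * y\<bar> ^ Suc 1 / fact (Suc 1) = h\<^sup>2 * (y\<^sup>2 / 2)"
      by (simp add: power2_eq_square)
    ultimately have "norm (iexp (h * y) - 1 - \<i> * of_real (h * y)) \<le> h\<^sup>2 * (y\<^sup>2 / 2)"
      by (simp add: diff_diff_eq)
    then show ?thesis using that by (simp add: g_def norm_divide norm_power field_simps)
  qed
  have cancel: "(a * b) ^ 3 / 6 / a\<^sup>2 = a * (b ^ 3 / 6)" if "a \<noteq> 0" for a b :: real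
    using that by (simp add: power2_eq_square power3_eq_cube)
  have g_lim: "(\<lambda>n. g y (r n)) \<longlonglongrightarrow> of_real (- y\<^sup>2 / 2)" for y
  proof (rule Lim_transform_bound[where g="\<lambda>n. \<bar>r n\<bar> * (\<bar>y\<bar> ^ 3 / 6)", THEN LIM_zero_cancel])
    show "\<forall>\<^sub>F n in sequentially. norm (g y (r n) - of_real (- y\<^sup>2 / 2)) \<le> norm (\<bar>r n\<bar> * (\<bar>y\<bar> ^ 3 / 6))"
      using r0
    proof eventually_elim
      case (elim n)
      define h where "h = r n"
      have "norm (iexp (h * y) - (\<Sum>k\<le>2. (\<i> * of_real (h * y)) ^ k / fact k)) \<le> \<bar>h * y\<bar> ^ Suc 2 / fact (Suc 2)"
        by (rule iexp_approx1)
      moreover have "(\<Sum>k\<le>2. (\<i> * of_real (h * y)) ^ k / fact k) = 1 + \<i> * of_real (h * y) + of_real (h\<^sup>2 * (- y\<^sup>2 / 2))"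
        by (simp add: numeral_2_eq_2 power_mult_distrib)
      moreover have "g y h - of_real (- y\<^sup>2 / 2) =
          (iexp (h * y) - (1 + \<i> * of_real (h * y) + of_real (h\<^sup>2 * (- y\<^sup>2 / 2)))) / (of_real h)\<^sup>2"
        using elim by (simp add: g_def h_def field_simps)
      moreover have "\<bar>h * y\<bar> ^ Suc 2 / fact (Suc 2) = \<bar>h * y\<bar> ^ 3 / 6"
        by (simp add: eval_nat_numeral fact_numeral)
      ultimately have "norm (g y h - of_real (- y\<^sup>2 / 2)) \<le> \<bar>h * y\<bar> ^ 3 / 6 / (norm (complex_of_real h))\<^sup>2"
        by (simp only: norm_divide norm_power divide_right_mono zero_le_power2)
      also have "\<dots> = \<bar>h\<bar> * (\<bar>y\<bar> ^ 3 / 6)"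
        unfolding norm_of_real abs_mult using elim by (intro cancel) (simp add: h_def)
      finally show ?case by (simp add: h_def abs_mult)
    qed
    show "(\<lambda>n. \<bar>r n\<bar> * (\<bar>y\<bar> ^ 3 / 6)) \<longlonglongrightarrow> 0"
      using r by (intro tendsto_mult_left_zero tendsto_rabs_zero)
  qed
  \<comment> \<open>The value 0 at \<open>r n = 0\<close> lets the domination, known from
    \<open>g_le\<close> for nonzero \<open>h\<close>, hold for every \<open>n\<close>; by
    \<open>r0\<close> this case does not occur for large \<open>n\<close>.\<close>
  have "(\<lambda>n. \<integral>x. (if r n = 0 then 0 else g (s \<bullet> x) (r n)) \<partial>\<L>) \<longlonglongrightarrow> (\<integral>x. of_real (- (s \<bullet> x)\<^sup>2 / 2) \<partial>\<L>)"
  proof (rule integral_dominated_convergence[where w="\<lambda>x. (s \<bullet> x)\<^sup>2 / 2"])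
    show "AE x in \<L>. (\<lambda>n. if r n = 0 then 0 else g (s \<bullet> x) (r n)) \<longlonglongrightarrow> of_real (- (s \<bullet> x)\<^sup>2 / 2)"
    proof (rule AE_I2)
      fix x
      show "(\<lambda>n. if r n = 0 then 0 else g (s \<bullet> x) (r n)) \<longlonglongrightarrow> of_real (- (s \<bullet> x)\<^sup>2 / 2)"
        by (rule Lim_transform_eventually[OF g_lim]) (use r0 in eventually_elim, simp)
    qed
    show "AE x in \<L>. norm (if r n = 0 then 0 else g (s \<bullet> x) (r n)) \<le> (s \<bullet> x)\<^sup>2 / 2" for n
      using g_le by auto
    show "(\<lambda>x. if r n = 0 then 0 else g (s \<bullet> x) (r n)) \<in> borel_measurable \<L>" for n
      unfolding g_def by measurable
  qed (use integrable_inner_square[of s] in auto)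
  also have "(\<integral>x. of_real (- (s \<bullet> x)\<^sup>2 / 2) \<partial>\<L>) = complex_of_real (- Q s / 2)"
    unfolding integral_complex_of_real Q_def by simp
  finally show ?thesis
  proof (rule Lim_transform_eventually)
    show "\<forall>\<^sub>F n in sequentially. (\<integral>x. (if r n = 0 then 0 else g (s \<bullet> x) (r n)) \<partial>\<L>) =
        (\<phi> (r n *\<^sub>R s) - 1 - \<i> * (r n * (s \<bullet> m))) / (r n)\<^sup>2"
      using r0
    proof eventually_elim
      case (elim n)
      have i1: "integrable \<L> (\<lambda>x. iexp (r n * (s \<bullet> x)))"
        by (rule \<L>.integrable_const_bound[where B=1]) auto
      have i2: "integrable \<L> (\<lambda>x. complex_of_real (r n * (s \<bullet> x)))"
        using integrable_inner[of s] by (intro integrable_of_real integrable_mult_right)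
      have "(\<integral>x. complex_of_real (r n * (s \<bullet> x)) \<partial>\<L>) = of_real (r n * (s \<bullet> m))"
        unfolding integral_complex_of_real m_def using integrable_id by simp
      then have "(\<integral>x. g (s \<bullet> x) (r n) \<partial>\<L>) = (\<phi> (r n *\<^sub>R s) - 1 - \<i> * (r n * (s \<bullet> m))) / (r n)\<^sup>2"
        unfolding g_def using i1 i2 \<L>.prob_space by (simp add: \<phi>_def del: of_real_mult)
      then show ?case using elim by simp
    qed
  qed
qed

text \<open>Follows from \<open>norm (1 - iexp y) \<le> \<bar>y\<bar>\<close>. Linearity in
  \<open>r\<close> makes the error probabilities summable along
  \<open>r = inverse ((real j)\<^sup>2)\<close>.\<close>

lemma norm_one_minus_\<phi>_le: "norm (1 - \<phi> (r *\<^sub>R s)) \<le> \<bar>r\<bar> * (\<integral>x. \<bar>s \<bullet> x\<bar> \<partial>\<L>)"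
proof -
  have i: "integrable \<L> (\<lambda>x. iexp (r *\<^sub>R s \<bullet> x))"
    by (rule \<L>.integrable_const_bound[where B=1]) auto
  have "1 - \<phi> (r *\<^sub>R s) = (\<integral>x. 1 - iexp (r *\<^sub>R s \<bullet> x) \<partial>\<L>)"
    using i \<L>.prob_space by (simp add: \<phi>_def)
  also have "norm \<dots> \<le> (\<integral>x. norm (1 - iexp (r *\<^sub>R s \<bullet> x)) \<partial>\<L>)"
    by (rule integral_norm_bound)
  also have "\<dots> \<le> (\<integral>x. \<bar>r\<bar> * \<bar>s \<bullet> x\<bar> \<partial>\<L>)"
  proof (rule integral_mono)
    show "norm (1 - iexp (r *\<^sub>R s \<bullet> x)) \<le> \<bar>r\<bar> * \<bar>s \<bullet> x\<bar>" for x
      using iexp_approx1[of "r *\<^sub>R s \<bullet> x" 0] by (simp add: norm_minus_commute abs_mult)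
  qed (use i integrable_inner[of s] in auto)
  finally show ?thesis by simp
qed

text \<open>In the exponent \<open>- (1 - \<phi>) * log_sum \<rho> n\<close> the sum may be replaced
  by the logarithm, because their difference converges and \<open>\<phi>\<close> tends to 1. The
  centering cancels the first-order term; what remains is
  \<open>ln (real n) / (grid_scale n)\<^sup>2\<close>, tending to 1, times the quotient in
  \<open>\<phi>_expansion\<close>.\<close>

lemma mean_factor_tendsto:
  "(\<lambda>n. mean_factor \<rho> (\<phi> (inverse (grid_scale n) *\<^sub>R s)) n * iexp (- (inverse (grid_scale n) * ln (real n) * (s \<bullet> m))))
    \<longlonglongrightarrow> of_real (exp (- Q s / 2))"
proof -
  define r where "r n = inverse (grid_scale n)" for n
  define c where "c n = \<phi> (r n *\<^sub>R s)" for n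
  have r: "r \<longlonglongrightarrow> 0" unfolding r_def by (rule inverse_scale_tendsto_0)
  have r0: "\<forall>\<^sub>F n in sequentially. r n \<noteq> 0"
    using eventually_scale_pos by eventually_elim (simp add: r_def)
  have c1: "(\<lambda>n. norm (1 - c n)) \<longlonglongrightarrow> 0"
  proof (rule Lim_null_comparison)
    show "\<forall>\<^sub>F n in sequentially. norm (norm (1 - c n)) \<le> \<bar>r n\<bar> * (\<integral>x. \<bar>s \<bullet> x\<bar> \<partial>\<L>)"
      using norm_one_minus_\<phi>_le by (simp add: c_def)
    show "(\<lambda>n. \<bar>r n\<bar> * (\<integral>x. \<bar>s \<bullet> x\<bar> \<partial>\<L>)) \<longlonglongrightarrow> 0"
      using r by (intro tendsto_mult_left_zero tendsto_rabs_zero)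
  qed
  define w where "w n = - ((1 - c n) * log_sum \<rho> n)" for n
  define v where "v n = - \<i> * (r n * ln (real n) * (s \<bullet> m))" for n
  have "(\<lambda>n. mean_factor \<rho> (c n) n - exp (w n)) \<longlonglongrightarrow> 0"
  proof (rule Lim_null_comparison)
    show "\<forall>\<^sub>F n in sequentially. norm (mean_factor \<rho> (c n) n - exp (w n)) \<le>
        exp 2 * (norm (1 - c n))\<^sup>2 * (\<Sum>i. inverse ((real (Suc i))\<^sup>2))"
      unfolding w_def c_def using mean_factor_approx[OF \<rho> norm_\<phi>] by simp
    have "(\<lambda>n. exp 2 * (norm (1 - c n))\<^sup>2 * (\<Sum>i. inverse ((real (Suc i))\<^sup>2))) \<longlonglongrightarrow>
        exp 2 * 0\<^sup>2 * (\<Sum>i. inverse ((real (Suc i))\<^sup>2))"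
      by (intro tendsto_intros c1)
    then show "(\<lambda>n. exp 2 * (norm (1 - c n))\<^sup>2 * (\<Sum>i. inverse ((real (Suc i))\<^sup>2))) \<longlonglongrightarrow> 0" by simp
  qed
  \<comment> \<open>\<open>v n\<close> is purely imaginary, so \<open>exp (v n)\<close> has modulus
    1.\<close>
  then have "(\<lambda>n. (mean_factor \<rho> (c n) n - exp (w n)) * exp (v n)) \<longlonglongrightarrow> 0"
    by (rule Lim_null_comparison[OF always_eventually[OF allI] tendsto_norm_zero, rotated]) (simp add: norm_mult v_def)
  moreover have "(\<lambda>n. exp (w n + v n)) \<longlonglongrightarrow> exp (of_real (- Q s / 2))"
  proof (rule tendsto_exp)
    obtain l where l: "(\<lambda>n. log_sum \<rho> n - ln (real n)) \<longlonglongrightarrow> l"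
      using convergent_log_sum[OF \<rho>] by (auto simp: convergent_def)
    have "(\<lambda>n. - (1 - c n) * of_real (log_sum \<rho> n - ln (real n)) + of_real (ln (real n) / (grid_scale n)\<^sup>2) *
        ((c n - 1 - \<i> * (r n * (s \<bullet> m))) / (r n)\<^sup>2)) \<longlonglongrightarrow> - 0 * of_real l + of_real 1 * of_real (- Q s / 2)"
      unfolding c_def
      by (intro tendsto_intros \<phi>_expansion r r0 l ln_scale_asymp c1[unfolded c_def tendsto_norm_zero_iff])
    then have "(\<lambda>n. - (1 - c n) * of_real (log_sum \<rho> n - ln (real n)) + of_real (ln (real n) / (grid_scale n)\<^sup>2) *
        ((c n - 1 - \<i> * (r n * (s \<bullet> m))) / (r n)\<^sup>2)) \<longlonglongrightarrow> of_real (- Q s / 2)"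
      by (simp only: minus_zero mult_zero_left add_0_left of_real_1 mult_1_left)
    then show "(\<lambda>n. w n + v n) \<longlonglongrightarrow> of_real (- Q s / 2)"
    proof (rule Lim_transform_eventually)
      show "\<forall>\<^sub>F n in sequentially. - (1 - c n) * of_real (log_sum \<rho> n - ln (real n)) + of_real (ln (real n) / (grid_scale n)\<^sup>2) *
        ((c n - 1 - \<i> * (r n * (s \<bullet> m))) / (r n)\<^sup>2) = w n + v n"
        using eventually_scale_pos
      proof eventually_elim
        case (elim n)
        have *: "complex_of_real (ln (real n) / (grid_scale n)\<^sup>2) * (x / complex_of_real ((r n)\<^sup>2)) = of_real (ln (real n)) * x" for x
          using elim by (simp add: r_def divide_inverse power_inverse)
        show ?case
          unfolding * w_def v_def by (simp add: algebra_simps)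
      qed
    qed
  qed
  ultimately have "(\<lambda>n. (mean_factor \<rho> (c n) n - exp (w n)) * exp (v n) + exp (w n + v n)) \<longlonglongrightarrow>
      0 + exp (of_real (- Q s / 2))"
    by (rule tendsto_add)
  moreover have "(mean_factor \<rho> (c n) n - exp (w n)) * exp (v n) + exp (w n + v n) = mean_factor \<rho> (c n) n * exp (v n)" for n
    by (simp add: exp_add left_diff_distrib)
  moreover have "exp (v n) = iexp (- (inverse (grid_scale n) * ln (real n) * (s \<bullet> m)))" for n
    by (simp add: v_def r_def)
  ultimately show ?thesis
    by (simp only: exp_of_real add_0_left c_def r_def)
qed

section \<open>Almost sure convergence at a fixed frequency and along the axes\<close>

lemma AE_ecf_approx:
  "AE \<omega> in M. (\<lambda>n. ecf (inverse (grid_scale n) *\<^sub>R s) n \<omega> - mean_factor \<rho> (\<phi> (inverse (grid_scale n) *\<^sub>R s)) n) \<longlonglongrightarrow> 0"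
proof -
  define t where "t j = inverse ((real j)\<^sup>2) *\<^sub>R s" for j :: nat
  define A where "A e j = {\<omega> \<in> space M. \<exists>n. e \<le> norm (ecf (t j) n \<omega> - mean_factor \<rho> (\<phi> (t j)) n)}" for e j
  define C where "C = (\<integral>x. \<bar>s \<bullet> x\<bar> \<partial>\<L>)"
  have t1: "norm (1 - \<phi> (t j)) \<le> C * inverse ((real j)\<^sup>2)" for j
    using norm_one_minus_\<phi>_le[of "inverse ((real j)\<^sup>2)" s] by (simp add: t_def C_def mult.commute)
  have sq: "summable (\<lambda>j. inverse ((real j)\<^sup>2))"
    using inverse_power_summable[of 2, where ?'a=real] by simp
  have A_ev: "A e j \<in> events" for e j unfolding A_def by measurable
  have "(\<lambda>j. C * inverse ((real j)\<^sup>2)) \<longlonglongrightarrow> 0"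
    using summable_LIMSEQ_zero[OF sq] by (intro tendsto_mult_right_zero)
  \<comment> \<open>This secures the smallness assumption of \<open>ecf_maximal_inequality\<close>
    for all but finitely many \<open>j\<close>, which is enough for summability.\<close>
  then have ev: "\<forall>\<^sub>F j in sequentially. C * inverse ((real j)\<^sup>2) < 1 / 8"
    by (rule order_tendstoD) simp
  have BC: "AE \<omega> in M. \<forall>\<^sub>F j in sequentially. \<omega> \<in> space M - A e j" if "e > 0" for e
  proof (rule borel_cantelli_AE1)
    show "summable (\<lambda>j. prob (A e j))"
    proof (rule summable_comparison_test_ev)
      show "\<forall>\<^sub>F j in sequentially. norm (prob (A e j)) \<le> (suminf variance_term * C / e\<^sup>2) * inverse ((real j)\<^sup>2)"
        using ev
      proof eventually_elim
        case (elim j)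
        have "prob (A e j) \<le> suminf variance_term * norm (1 - \<phi> (t j)) / e\<^sup>2"
          unfolding A_def using t1[of j] elim that by (intro ecf_maximal_inequality) auto
        also have "\<dots> \<le> suminf variance_term * (C * inverse ((real j)\<^sup>2)) / e\<^sup>2"
          by (intro divide_right_mono mult_left_mono t1 suminf_nonneg summable_variance_term variance_term_nonneg) auto
        finally show ?case by (simp add: mult_ac)
      qed
      show "summable (\<lambda>j. (suminf variance_term * C / e\<^sup>2) * inverse ((real j)\<^sup>2))"
        using sq by (rule summable_mult)
    qed
  qed (use A_ev in \<open>auto simp: emeasure_eq_measure\<close>)
  \<comment> \<open>Countably many thresholds, so that one null set serves every
    \<open>e > 0\<close>.\<close>
  have "AE \<omega> in M. \<forall>k. \<forall>\<^sub>F j in sequentially. \<omega> \<in> space M - A (inverse (real (Suc k))) j"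
    unfolding AE_all_countable by (intro allI BC) simp
  then show ?thesis
  proof eventually_elim
    case (elim \<omega>)
    show ?case
    proof (rule tendstoI)
      fix e :: real assume "e > 0"
      then obtain k where k: "inverse (real (Suc k)) < e" using reals_Archimedean by blast
      \<comment> \<open>Off \<open>A e j\<close> the deviation at frequency \<open>t j\<close> is
        small for all \<open>n\<close> at once. Hence \<open>j = level n\<close> may be inserted
        although many \<open>n\<close> share the same level.\<close>
      have "\<forall>\<^sub>F n in sequentially. \<omega> \<in> space M - A (inverse (real (Suc k))) (level n)"
        using elim level_at_top by (auto simp: filterlim_iff)
      then show "\<forall>\<^sub>F n in sequentially. dist (ecf (inverse (grid_scale n) *\<^sub>R s) n \<omega> - mean_factor \<rho> (\<phi> (inverse (grid_scale n) *\<^sub>R s)) n) 0 < e"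
      proof eventually_elim
        case (elim n)
        then have "\<not> inverse (real (Suc k)) \<le> norm (ecf (t (level n)) n \<omega> - mean_factor \<rho> (\<phi> (t (level n))) n)"
          unfolding A_def by blast
        then show ?case using k unfolding t_def by simp
      qed
    qed
  qed
qed

lemma AE_ecf_tendsto:
  "AE \<omega> in M. (\<lambda>n. ecf (inverse (grid_scale n) *\<^sub>R s) n \<omega> * iexp (- (inverse (grid_scale n) * ln (real n) * (s \<bullet> m))))
    \<longlonglongrightarrow> of_real (exp (- Q s / 2))"
  using AE_ecf_approx[of s]
proof eventually_elim
  case (elim \<omega>)
  then have "(\<lambda>n. (ecf (inverse (grid_scale n) *\<^sub>R s) n \<omega> - mean_factor \<rho> (\<phi> (inverse (grid_scale n) *\<^sub>R s)) n) *
      iexp (- (inverse (grid_scale n) * ln (real n) * (s \<bullet> m)))) \<longlonglongrightarrow> 0"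
    by (rule Lim_null_comparison[OF always_eventually[OF allI] tendsto_norm_zero, rotated]) (simp add: norm_mult)
  from tendsto_add[OF this mean_factor_tendsto[of s]] show ?case by (simp add: left_diff_distrib)
qed

definition rescaled_char :: "real ^ 'd \<Rightarrow> nat \<Rightarrow> 'a \<Rightarrow> complex" where
  "rescaled_char s n \<omega> = ecf (inverse (grid_scale n) *\<^sub>R s) n \<omega> * iexp (- (inverse (grid_scale n) * ln (real n) * (s \<bullet> m)))"

lemma char_rescale_empirical:
  "(\<integral>y. iexp (s \<bullet> y) \<partial>rescale (grid_scale n) (ln (real n) *\<^sub>R m) (empirical_dist \<rho> n (\<lambda>v. X v \<omega>))) = rescaled_char s n \<omega>"
proof -
  have "iexp (s \<bullet> ((X v \<omega> - ln (real n) *\<^sub>R m) /\<^sub>R grid_scale n)) =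
      wave (inverse (grid_scale n) *\<^sub>R s) v \<omega> * iexp (- (inverse (grid_scale n) * ln (real n) * (s \<bullet> m)))" for v
    unfolding wave_def exp_add[symmetric]
    by (intro arg_cong[where f=exp]) (simp add: inner_diff_right algebra_simps)
  then show ?thesis
    by (subst integral_rescale_empirical[OF \<rho>])
      (simp_all add: rescaled_char_def ecf_def sum_distrib_left sum_distrib_right mult_ac)
qed

lemma Q_nonneg: "0 \<le> Q s"
  by (simp add: Q_def)

lemma Q_scaleR: "Q (r *\<^sub>R s) = r\<^sup>2 * Q s"
  by (simp add: Q_def power_mult_distrib)

text \<open>Fubini's theorem turns the almost sure statement at each fixed frequency around: one
  null set of outcomes serves almost every frequency on the axis. The normal law is the measure over
  which \<open>tight_of_AE_char\<close> averages.\<close>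

lemma AE_rescaled_char_axis:
  "AE \<omega> in M. AE u in std_normal_distribution.
    (\<lambda>n. rescaled_char (axis i (u / real k)) n \<omega>) \<longlonglongrightarrow> of_real (exp (- ((u / real k)\<^sup>2 * Q (axis i 1) / 2)))"
proof -
  have ax: "axis i (u / real k) = (u / real k) *\<^sub>R axis i 1" for u
    by (simp add: vec_eq_iff axis_def)
  have Q_ax: "Q (axis i (u / real k)) = (u / real k)\<^sup>2 * Q (axis i 1)" for u
    unfolding ax Q_scaleR ..
  interpret \<gamma>: prob_space std_normal_distribution by (rule prob_space_normal_density) simp
  interpret pair_sigma_finite M std_normal_distribution ..
  have "AE u in std_normal_distribution. AE \<omega> in M.
    (\<lambda>n. rescaled_char (axis i (u / real k)) n \<omega>) \<longlonglongrightarrow> of_real (exp (- ((u / real k)\<^sup>2 * Q (axis i 1) / 2)))"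
  proof (rule AE_I2)
    fix u
    show "AE \<omega> in M. (\<lambda>n. rescaled_char (axis i (u / real k)) n \<omega>) \<longlonglongrightarrow>
        of_real (exp (- ((u / real k)\<^sup>2 * Q (axis i 1) / 2)))"
      using AE_ecf_tendsto[of "axis i (u / real k)"] by (simp add: rescaled_char_def Q_ax)
  qed
  moreover have "{z \<in> space (M \<Otimes>\<^sub>M std_normal_distribution).
      (\<lambda>n. rescaled_char (axis i (snd z / real k)) n (fst z)) \<longlonglongrightarrow>
      complex_of_real (exp (- ((snd z / real k)\<^sup>2 * Q (axis i 1) / 2)))} \<in> sets (M \<Otimes>\<^sub>M std_normal_distribution)"
    by (rule measurable_tendsto_pred) (unfold ax rescaled_char_def ecf_def wave_def, measurable)
  ultimately show ?thesis by (subst AE_commute)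
qed

section \<open>The limiting covariance matrix and the conclusion\<close>

definition second_moment :: "real ^ 'd ^ 'd" where
  "second_moment = (\<chi> i j. \<integral>x. x $ i * x $ j \<partial>\<L>)"

lemma transpose_second_moment: "transpose second_moment = second_moment"
  by (simp add: second_moment_def transpose_def vec_eq_iff mult.commute)

text \<open>Identifies the exponent of the limit with a quadratic form; with \<open>Q_nonneg\<close>
  it also gives the positive semidefiniteness that \<open>char_centered_normal\<close> asks
  for.\<close>

lemma inner_second_moment: "s \<bullet> (second_moment *v s) = Q s"
proof -
  have [measurable]: "(\<lambda>x. x $ i) \<in> borel_measurable (borel :: (real ^ 'd) measure)" for i
    by (intro borel_measurable_continuous_onI continuous_intros)
  have i: "integrable \<L> (\<lambda>x. x $ i * x $ j)" for i j
  proof (rule Bochner_Integration.integrable_bound[OF moment])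
    have "norm (x $ i * x $ j) \<le> norm ((norm x)\<^sup>2)" for x :: "real ^ 'd"
      using mult_mono[OF component_le_norm_cart[of x i] component_le_norm_cart[of x j]]
      by (simp add: abs_mult power2_eq_square)
    then show "AE x in \<L>. norm (x $ i * x $ j) \<le> norm ((norm x)\<^sup>2)" by simp
  qed measurable
  have "Q s = (\<integral>x. (\<Sum>i\<in>UNIV. \<Sum>j\<in>UNIV. s $ i * s $ j * (x $ i * x $ j)) \<partial>\<L>)"
    unfolding Q_def
    by (intro Bochner_Integration.integral_cong) (simp_all add: inner_vec_def power2_eq_square sum_product mult_ac)
  also have "\<dots> = (\<Sum>i\<in>UNIV. \<Sum>j\<in>UNIV. s $ i * s $ j * (\<integral>x. x $ i * x $ j \<partial>\<L>))"
    using i by simp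
  also have "\<dots> = s \<bullet> (second_moment *v s)"
    by (simp add: inner_vec_def matrix_vector_mult_def second_moment_def sum_distrib_left mult_ac)
  finally show ?thesis by simp
qed

lemma char_limit: "(\<integral>x. iexp (s \<bullet> x) \<partial>centered_normal second_moment) = of_real (exp (- Q s / 2))"
  using char_centered_normal[OF transpose_second_moment, of s] Q_nonneg
  by (simp add: inner_second_moment exp_of_real)

lemma sets_centered_normal: "sets (centered_normal S) = sets borel"
  by (simp add: centered_normal_def)

lemma AE_weakly_converges:
  "AE \<omega> in M. weakly_converges
     (\<lambda>n. rescale (sqrt (ln (real n))) (ln (real n) *\<^sub>R m) (empirical_dist \<rho> n (\<lambda>v. X v \<omega>)))
     (centered_normal second_moment)"
proof -
  \<comment> \<open>The rational frequencies, being countable, share one null set; they identify the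
    limit.\<close>
  have "AE \<omega> in M. \<forall>s\<in>{u. \<forall>i. u $ i \<in> \<rat>}. (\<lambda>n. rescaled_char s n \<omega>) \<longlonglongrightarrow> of_real (exp (- Q s / 2))"
    unfolding rescaled_char_def using AE_ecf_tendsto
    by (subst AE_ball_countable[OF countable_rational_vectors]) blast
  \<comment> \<open>The frequencies on the axes provide tightness.\<close>
  moreover have "AE \<omega> in M. \<forall>i\<in>UNIV. \<forall>k. AE u in std_normal_distribution.
    (\<lambda>n. rescaled_char (axis i (u / real k)) n \<omega>) \<longlonglongrightarrow> of_real (exp (- ((u / real k)\<^sup>2 * Q (axis i 1) / 2)))"
    using AE_rescaled_char_axis by (intro AE_finite_allI finite) (simp add: AE_all_countable)
  ultimately show ?thesis
  proof eventually_elim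
    case (elim \<omega>)
    define \<mu> where "\<mu> n = rescale (grid_scale n) (ln (real n) *\<^sub>R m) (empirical_dist \<rho> n (\<lambda>v. X v \<omega>))" for n
    have \<mu>: "prob_space (\<mu> n)" "sets (\<mu> n) = sets borel" for n
      using prob_space_rescale_empirical[OF \<rho>] by (simp_all add: \<mu>_def)
    have tight: "\<exists>K. \<forall>\<^sub>F n in sequentially. measure (\<mu> n) {x. K < norm x} \<le> e" if "e > 0" for e
      using elim(2) by (intro tight_of_AE_char[where q="\<lambda>i. Q (axis i 1)", OF \<mu> Q_nonneg _ that]) (simp add: \<mu>_def char_rescale_empirical)
    have "weakly_converges \<mu> (centered_normal second_moment)"
      using elim(1)
      by (intro weakly_converges_of_char \<mu> prob_space_centered_normal sets_centered_normal tight)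
        (simp_all add: \<mu>_def char_rescale_empirical char_limit)
    from weakly_converges_scaleR[OF this \<mu> tight scale_asymp]
    have *: "weakly_converges (\<lambda>n. distr (\<mu> n) borel (\<lambda>x. (grid_scale n / sqrt (ln (real n))) *\<^sub>R x)) (centered_normal second_moment)" .
    \<comment> \<open>For the first few \<open>n\<close> the grid scale is 0 and cannot be undone by
      a dilation; this does not affect the limit.\<close>
    have ev: "\<forall>\<^sub>F n in sequentially. distr (\<mu> n) borel (\<lambda>x. (grid_scale n / sqrt (ln (real n))) *\<^sub>R x) =
        rescale (sqrt (ln (real n))) (ln (real n) *\<^sub>R m) (empirical_dist \<rho> n (\<lambda>v. X v \<omega>))"
      using eventually_scale_pos
    proof eventually_elim
      case (elim n)
      then show ?case unfolding \<mu>_def by (intro distr_scaleR_rescale) (simp_all add: empirical_dist_def)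
    qed
    show ?case
      unfolding weakly_converges_def
    proof (intro allI impI)
      fix f :: "real ^ 'd \<Rightarrow> real"
      assume f: "continuous_on UNIV f" "bounded (range f)"
      show "(\<lambda>n. integral\<^sup>L (rescale (sqrt (ln (real n))) (ln (real n) *\<^sub>R m) (empirical_dist \<rho> n (\<lambda>v. X v \<omega>))) f)
          \<longlonglongrightarrow> integral\<^sup>L (centered_normal second_moment) f"
      proof (rule Lim_transform_eventually)
        show "(\<lambda>n. integral\<^sup>L (distr (\<mu> n) borel (\<lambda>x. (grid_scale n / sqrt (ln (real n))) *\<^sub>R x)) f)
          \<longlonglongrightarrow> integral\<^sup>L (centered_normal second_moment) f"
          using * f unfolding weakly_converges_def by blast
      qed (use ev in eventually_elim, simp)
    qed
  qed
qed

end

theorem theorem6p1: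
  fixes P :: "'b measure" and Y :: "'b \<Rightarrow> real ^ 'd"
    and M :: "'a measure" and \<rho> :: real
    and par :: "nat \<Rightarrow> 'a \<Rightarrow> nat" and \<eta> X :: "nat \<Rightarrow> 'a \<Rightarrow> real ^ 'd"
  assumes "prob_space P" and "Y \<in> borel_measurable P"
    and "integrable P (\<lambda>\<omega>. (norm (Y \<omega>))\<^sup>2)"
    and "prob_space M" and "\<rho> > 0"
    and "weighted_random_recursive_tree \<rho> M par"
    and "branching_random_walk M par (distr P borel Y) \<eta> X"
  shows "AE \<omega> in M. weakly_converges
           (\<lambda>n. rescale (sqrt (ln (real n))) (ln (real n) *\<^sub>R (\<integral>\<omega>'. Y \<omega>' \<partial>P))
                  (empirical_dist \<rho> n (\<lambda>v. X v \<omega>)))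
           (centered_normal (\<chi> i j. \<integral>\<omega>'. Y \<omega>' $ i * Y \<omega>' $ j \<partial>P))"
proof -
  note [measurable] = assms(2)
  interpret prob_space M by (rule assms(4))
  \<comment> \<open>The locale sees only the law of the offset; its mean and second moments are
    carried back to \<open>Y\<close> by change of variables.\<close>
  interpret square_integrable_walk M \<rho> par "distr P borel Y" \<eta> X
    by unfold_locales (use assms in \<open>auto simp: integrable_distr_eq\<close>)
  have [measurable]: "(\<lambda>x. x $ i) \<in> borel_measurable (borel :: (real ^ 'd) measure)" for i
    by (intro borel_measurable_continuous_onI continuous_intros)
  have "m = (\<integral>\<omega>'. Y \<omega>' \<partial>P)"
    by (simp add: m_def integral_distr)
  moreover have "second_moment = (\<chi> i j. \<integral>\<omega>'. Y \<omega>' $ i * Y \<omega>' $ j \<partial>P)"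
    by (simp add: second_moment_def integral_distr)
  ultimately show ?thesis using AE_weakly_converges by simp
qed

end
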